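(* Let $X$ be a Banach space with a shrinking unconditional basis, and let $1\le p<\infty$ with $p\neq 2$. If $X$ is an asymptotic $\ell_p$-space, then every twisted spreading model of the twisted Hilbert space $Z(X)$ is isomorphic to the Kalton-Peck space $Z_2$.
   Context: Spaces are infinite-dimensional Banach spaces over $\mathbb C$. $\omega$ is the space of all complex sequences with pointwise convergence; $c_{00}$ is the space of finitely supported sequences. For finitely supported $x,y$, $x<y$ means $\max\operatorname{supp}x<\min\operatorname{supp}y$, and $n<x$ means $n<\min\operatorname{supp}x$; consecutive blocks are finitely supported vectors $u_1<u_2<\dots$. A space $X$ with an unconditional basis $(e_j)$ is regarded as a sequence space in $\omega$ through its basis (renormed, if necessary, so that the basis is 1-unconditional), and $X^*$ is regarded as a sequence space through $x^*\mapsto (x^*(e_j))_j$. Asymptotic $\ell_p$-space: there is $C>0$ such that for every $n\in\mathbb N$ and all normalized blocks $n<u_1<\dots<u_n$ of the basis, $(u_j)_{j=1}^n$ is $C$-equivalent to the unit vector basis of $\ell_p^n$. The space $Z(X)$. Let $\mathbb S=\{z\in\mathbb C:0\le \operatorname{Re}z\le 1\}$. $\mathcal F_\infty(X,X^* )$ is the space of functions $F:\mathbb S\to\omega$, bounded and continuous on $\mathbb S$, analytic in its interior, such that $t\mapsto F(it)\in X$ and $t\mapsto F(1+it)\in X^*$ are bounded and continuous, with norm $\max(\sup_t\|F(it)\|_X,\sup_t\|F(1+it)\|_{X^*})$. The interpolation space $(X,X^* )_{1/2}=\{F(1/2):F\in\mathcal F_\infty(X,X^* )\}$ with the quotient norm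 equals $\ell_2$ up to an equivalent norm. Fix a homogeneous selection $x\in\ell_2\mapsto B(x)\in\mathcal F_\infty(X,X^* )$ with $B(x)(1/2)=x$ and $\|B(x)\|\le C\|x\|_2$, and put $\Omega(x)=B(x)'(1/2)\in\omega$. Then $Z(X)=\{(x,y)\in\omega\times\omega: y\in\ell_2,\ x-\Omega(y)\in\ell_2\}$ with the quasi-norm $\|(x,y)\|=\|x-\Omega(y)\|_2+\|y\|_2$ (which is equivalent to a norm). The selection used on finitely supported $u$ with $\|u\|_2=1$ is the following: write $|u|^2=|v|\,|w|$ with $\|v\|_X,\|w\|_{X^*}\le1$ and $\operatorname{supp}u=\operatorname{supp}v=\operatorname{supp}w$ (Lozanovskii factorization) and take $B(u)(z)=u|v|^{1/2-z}|w|^{z-1/2}$ coordinatewise on $\operatorname{supp}u$, extended homogeneously. Kalton-Peck space: $Z_2=\{(x,y)\in\omega\times\omega:\ y\in \ell_2,\ x-\mathcal K(y)\in\ell_2\}$ with $\|(x,y)\|_{Z_2}=\|x-\mathcal K(y)\|_2+\|y\|_2$, where $\mathcal K(y)=\sum_j y_j\log|y_j|\,e_j$ for $\|y\|_2=1$ (with $0\log 0=0$), extended homogeneously. Twisted spreading model of $Z(X)$ (with centralizer $\Omega$): let $(u_j)$ be a sequence of normalized consecutive blocks in $\ell_2$ such that (after passing to a subsequence; this is always possible) for every $n$ and all scalars $a_1,\dots,a_n,b_1,\dots,b_n$ the limit $$\lim_{\nu\to\infty,\ \nu<k_1<\dots<k_n}\Big(\Big\|\sum_{j=1}^n a_ju_{k_j}+\sum_{j=1}^n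 b_j\Omega(u_{k_j})-\Omega\Big(\sum_{j=1}^n b_ju_{k_j}\Big)\Big\|_2+\Big\|\sum_{j=1}^n b_ju_{k_j}\Big\|_2\Big)$$ exists. The completion of $c_{00}\times c_{00}$ under the quasi-norm $\|(a,b)\|$ given by this limit is a twisted spreading model of $Z(X)$. *)

theory Defs
  imports "HOL-Analysis.Analysis" "HOL-Library.Function_Algebras"
begin

section \<open>Scalar sequences\<close>

type_synonym cseq = "nat \<Rightarrow> complex"

definition seq_scale :: "complex \<Rightarrow> cseq \<Rightarrow> cseq" where
  "seq_scale c x = (\<lambda>j. c * x j)"

definition seq2_scale :: "complex \<Rightarrow> cseq \<times> cseq \<Rightarrow> cseq \<times> cseq" where
  "seq2_scale c xy = (seq_scale c (fst xy), seq_scale c (snd xy))"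

definition supp :: "cseq \<Rightarrow> nat set" where
  "supp x = {j. x j \<noteq> 0}"

definition c00 :: "cseq set" where
  "c00 = {x. finite (supp x)}"

definition l2 :: "cseq set" where
  "l2 = {x. summable (\<lambda>j. (cmod (x j))\<^sup>2)}"

definition l2_norm :: "cseq \<Rightarrow> real" where
  "l2_norm x = sqrt (\<Sum>j. (cmod (x j))\<^sup>2)"

text \<open>For nonzero finitely supported vectors this is \<open>max supp x < min supp y\<close>.\<close>

definition block_less :: "cseq \<Rightarrow> cseq \<Rightarrow> bool" where
  "block_less x y \<longleftrightarrow> (\<forall>i\<in>supp x. \<forall>j\<in>supp y. i < j)"

definition truncate :: "nat \<Rightarrow> cseq \<Rightarrow> cseq" where
  "truncate n a = (\<lambda>j. if j < n then a j else 0)"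


section \<open>Complex Banach spaces and bases\<close>

text \<open>A complex Banach space is a (real) Banach space with a compatible complex scalar
  multiplication for which the norm is homogeneous.\<close>

locale complex_banach = vector_space sc
  for sc :: "complex \<Rightarrow> 'a::banach \<Rightarrow> 'a" +
  assumes norm_scale: "norm (sc c x) = cmod c * norm x"
    and scale_of_real: "sc (complex_of_real r) x = r *\<^sub>R x"

definition schauder_basis :: "(complex \<Rightarrow> 'a::banach \<Rightarrow> 'a) \<Rightarrow> (nat \<Rightarrow> 'a) \<Rightarrow> bool" where
  "schauder_basis sc e \<longleftrightarrow> (\<forall>x. \<exists>!a. (\<lambda>j. sc (a j) (e j)) sums x)"

definition coords :: "(complex \<Rightarrow> 'a::banach \<Rightarrow> 'a) \<Rightarrow> (nat \<Rightarrow> 'a) \<Rightarrow> 'a \<Rightarrow> cseq" where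
  "coords sc e x = (THE a. (\<lambda>j. sc (a j) (e j)) sums x)"

text \<open>\<open>has_sum\<close> over \<open>UNIV\<close> is unconditional convergence of the series.\<close>

definition unconditional_basis :: "(complex \<Rightarrow> 'a::banach \<Rightarrow> 'a) \<Rightarrow> (nat \<Rightarrow> 'a) \<Rightarrow> bool" where
  "unconditional_basis sc e \<longleftrightarrow> schauder_basis sc e \<and>
     (\<forall>x. ((\<lambda>j. sc (coords sc e x j) (e j)) has_sum x) UNIV)"

definition dual :: "(complex \<Rightarrow> 'a::banach \<Rightarrow> 'a) \<Rightarrow> ('a \<Rightarrow> complex) set" where
  "dual sc = {\<phi>. bounded_linear \<phi> \<and> (\<forall>c x. \<phi> (sc c x) = c * \<phi> x)}"

text \<open>The biorthogonal functionals \<open>x \<mapsto> coords x j\<close> form a basis of the dual; the only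
  possible coefficients of a functional \<open>\<phi>\<close> are \<open>\<phi> (e j)\<close>.\<close>

definition shrinking_basis :: "(complex \<Rightarrow> 'a::banach \<Rightarrow> 'a) \<Rightarrow> (nat \<Rightarrow> 'a) \<Rightarrow> bool" where
  "shrinking_basis sc e \<longleftrightarrow> schauder_basis sc e \<and>
     (\<forall>\<phi>\<in>dual sc.
        (\<lambda>n. onorm (\<lambda>x. \<phi> x - (\<Sum>j<n. \<phi> (e j) * coords sc e x j))) \<longlonglongrightarrow> 0)"

definition synth :: "(complex \<Rightarrow> 'a::banach \<Rightarrow> 'a) \<Rightarrow> (nat \<Rightarrow> 'a) \<Rightarrow> cseq \<Rightarrow> 'a" where
  "synth sc e a = (\<Sum>j. sc (a j) (e j))"

text \<open>The basis is indexed from 0, so \<open>e i\<close> is the basis vector number \<open>i + 1\<close>, and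
  \<open>n < u\<close> reads \<open>n \<le> i\<close> for all \<open>i\<close> in the support.\<close>

definition asymptotic_lp ::
  "(complex \<Rightarrow> 'a::banach \<Rightarrow> 'a) \<Rightarrow> (nat \<Rightarrow> 'a) \<Rightarrow> real \<Rightarrow> bool" where
  "asymptotic_lp sc e p \<longleftrightarrow>
     (\<exists>C>0. \<forall>n u.
        (\<forall>j<n. u j \<in> c00 \<and> norm (synth sc e (u j)) = 1 \<and> (\<forall>i\<in>supp (u j). n \<le> i)) \<and>
        (\<forall>j. Suc j < n \<longrightarrow> block_less (u j) (u (Suc j))) \<longrightarrow>
        (\<forall>c :: nat \<Rightarrow> complex.
           (\<Sum>j<n. cmod (c j) powr p) powr (1 / p) / C
             \<le> norm (\<Sum>j<n. sc (c j) (synth sc e (u j))) \<and>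
           norm (\<Sum>j<n. sc (c j) (synth sc e (u j)))
             \<le> C * (\<Sum>j<n. cmod (c j) powr p) powr (1 / p)))"

definition equivalent_norm :: "(complex \<Rightarrow> 'a::banach \<Rightarrow> 'a) \<Rightarrow> ('a \<Rightarrow> real) \<Rightarrow> bool" where
  "equivalent_norm sc N \<longleftrightarrow>
     (\<forall>x y. N (x + y) \<le> N x + N y) \<and> (\<forall>c x. N (sc c x) = cmod c * N x) \<and>
     (\<exists>A>0. \<exists>B>0. \<forall>x. A * norm x \<le> N x \<and> N x \<le> B * norm x)"

definition one_unconditional ::
  "(complex \<Rightarrow> 'a::banach \<Rightarrow> 'a) \<Rightarrow> (nat \<Rightarrow> 'a) \<Rightarrow> ('a \<Rightarrow> real) \<Rightarrow> bool" where
  "one_unconditional sc e N \<longleftrightarrow>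
     (\<forall>x y. (\<forall>j. cmod (coords sc e x j) \<le> cmod (coords sc e y j)) \<longrightarrow> N x \<le> N y)"


section \<open>The space and its dual as sequence spaces\<close>

definition seq_space :: "(complex \<Rightarrow> 'a::banach \<Rightarrow> 'a) \<Rightarrow> (nat \<Rightarrow> 'a) \<Rightarrow> cseq set" where
  "seq_space sc e = range (coords sc e)"

definition seq_norm ::
  "(complex \<Rightarrow> 'a::banach \<Rightarrow> 'a) \<Rightarrow> (nat \<Rightarrow> 'a) \<Rightarrow> ('a \<Rightarrow> real) \<Rightarrow> cseq \<Rightarrow> real" where
  "seq_norm sc e N a = N (synth sc e a)"

definition dual_seq_space :: "(complex \<Rightarrow> 'a::banach \<Rightarrow> 'a) \<Rightarrow> (nat \<Rightarrow> 'a) \<Rightarrow> cseq set" where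
  "dual_seq_space sc e = (\<lambda>\<phi> j. \<phi> (e j)) ` dual sc"

definition dual_seq_norm ::
  "(complex \<Rightarrow> 'a::banach \<Rightarrow> 'a) \<Rightarrow> (nat \<Rightarrow> 'a) \<Rightarrow> ('a \<Rightarrow> real) \<Rightarrow> cseq \<Rightarrow> real" where
  "dual_seq_norm sc e N w =
     (SUP x\<in>{x. N x \<le> 1}. cmod ((THE \<phi>. \<phi> \<in> dual sc \<and> (\<forall>j. \<phi> (e j) = w j)) x))"


section \<open>Complex interpolation\<close>

definition strip :: "complex set" where
  "strip = {z. 0 \<le> Re z \<and> Re z \<le> 1}"

text \<open>A map defined on the strip with values in the space of all sequences is represented by
  its values on the strip; the topology on sequences is the product topology.\<close>

definition F_infty ::
  "cseq set \<Rightarrow> (cseq \<Rightarrow> real) \<Rightarrow> cseq set \<Rightarrow> (cseq \<Rightarrow> real) \<Rightarrow> (complex \<Rightarrow> cseq) set" where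
  "F_infty V0 N0 V1 N1 =
     {F. continuous_on strip F \<and> (\<forall>j. bounded ((\<lambda>z. F z j) ` strip)) \<and>
         (\<forall>j. (\<lambda>z. F z j) holomorphic_on interior strip) \<and>
         (\<forall>t. F (\<i> * complex_of_real t) \<in> V0) \<and>
         bdd_above (range (\<lambda>t. N0 (F (\<i> * complex_of_real t)))) \<and>
         (\<forall>t. ((\<lambda>s. N0 (F (\<i> * complex_of_real s) - F (\<i> * complex_of_real t))) \<longlongrightarrow> 0) (at t)) \<and>
         (\<forall>t. F (1 + \<i> * complex_of_real t) \<in> V1) \<and>
         bdd_above (range (\<lambda>t. N1 (F (1 + \<i> * complex_of_real t)))) \<and>
         (\<forall>t. ((\<lambda>s. N1 (F (1 + \<i> * complex_of_real s) - F (1 + \<i> * complex_of_real t))) \<longlongrightarrow> 0) (at t))}"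

definition F_infty_norm ::
  "(cseq \<Rightarrow> real) \<Rightarrow> (cseq \<Rightarrow> real) \<Rightarrow> (complex \<Rightarrow> cseq) \<Rightarrow> real" where
  "F_infty_norm N0 N1 F =
     max (SUP t. N0 (F (\<i> * complex_of_real t))) (SUP t. N1 (F (1 + \<i> * complex_of_real t)))"

definition lozanovskii_factorization ::
  "cseq set \<Rightarrow> (cseq \<Rightarrow> real) \<Rightarrow> cseq set \<Rightarrow> (cseq \<Rightarrow> real) \<Rightarrow> cseq \<Rightarrow> cseq \<Rightarrow> cseq \<Rightarrow> bool" where
  "lozanovskii_factorization V0 N0 V1 N1 u v w \<longleftrightarrow>
     (\<forall>j. (cmod (u j))\<^sup>2 = cmod (v j) * cmod (w j)) \<and>
     v \<in> V0 \<and> N0 v \<le> 1 \<and> w \<in> V1 \<and> N1 w \<le> 1 \<and> supp v = supp u \<and> supp w = supp u"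

definition selection ::
  "cseq set \<Rightarrow> (cseq \<Rightarrow> real) \<Rightarrow> cseq set \<Rightarrow> (cseq \<Rightarrow> real) \<Rightarrow>
   (cseq \<Rightarrow> complex \<Rightarrow> cseq) \<Rightarrow> bool" where
  "selection V0 N0 V1 N1 B \<longleftrightarrow>
     (\<forall>x\<in>l2. B x \<in> F_infty V0 N0 V1 N1 \<and> B x (1 / 2) = x) \<and>
     (\<forall>x\<in>l2. \<forall>c. \<forall>z\<in>strip. B (seq_scale c x) z = seq_scale c (B x z)) \<and>
     (\<exists>C. \<forall>x\<in>l2. F_infty_norm N0 N1 (B x) \<le> C * l2_norm x) \<and>
     (\<forall>u\<in>c00. l2_norm u = 1 \<longrightarrow>
        (\<exists>v w. lozanovskii_factorization V0 N0 V1 N1 u v w \<and>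
           (\<forall>z\<in>strip. \<forall>j. B u z j =
              u j * complex_of_real (cmod (v j)) powr (1 / 2 - z)
                  * complex_of_real (cmod (w j)) powr (z - 1 / 2))))"

definition derivation :: "(cseq \<Rightarrow> complex \<Rightarrow> cseq) \<Rightarrow> cseq \<Rightarrow> cseq" where
  "derivation B x = (\<lambda>j. deriv (\<lambda>z. B x z j) (1 / 2))"


section \<open>Twisted Hilbert spaces\<close>

definition twisted_space :: "(cseq \<Rightarrow> cseq) \<Rightarrow> (cseq \<times> cseq) set" where
  "twisted_space \<Omega> = {(x, y). y \<in> l2 \<and> x - \<Omega> y \<in> l2}"

definition twisted_norm :: "(cseq \<Rightarrow> cseq) \<Rightarrow> cseq \<times> cseq \<Rightarrow> real" where
  "twisted_norm \<Omega> = (\<lambda>(x, y). l2_norm (x - \<Omega> y) + l2_norm y)"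

text \<open>The homogeneous extension of \<open>y \<mapsto> (y j * ln |y j|)\<^sub>j\<close> from the unit sphere of \<open>l2\<close>.\<close>

definition kalton_peck_map :: "cseq \<Rightarrow> cseq" where
  "kalton_peck_map y = (\<lambda>j. y j * complex_of_real (ln (cmod (y j) / l2_norm y)))"


section \<open>Quasi-normed spaces, completions, isomorphisms\<close>

locale quasi_normed_space = vector_space sc
  for sc :: "complex \<Rightarrow> 'b::ab_group_add \<Rightarrow> 'b" +
  fixes V :: "'b set" and q :: "'b \<Rightarrow> real"
  assumes subspace_V: "subspace V"
    and q_nonneg: "x \<in> V \<Longrightarrow> 0 \<le> q x"
    and q_eq_0: "x \<in> V \<Longrightarrow> q x = 0 \<longleftrightarrow> x = 0"
    and q_scale: "x \<in> V \<Longrightarrow> q (sc c x) = cmod c * q x"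
    and q_triangle: "\<exists>K. \<forall>x\<in>V. \<forall>y\<in>V. q (x + y) \<le> K * (q x + q y)"

definition q_complete :: "'b::ab_group_add set \<Rightarrow> ('b \<Rightarrow> real) \<Rightarrow> bool" where
  "q_complete V q \<longleftrightarrow>
     (\<forall>s. (\<forall>n. s n \<in> V) \<and> (\<forall>\<epsilon>>0. \<exists>M. \<forall>m\<ge>M. \<forall>n\<ge>M. q (s m - s n) < \<epsilon>) \<longrightarrow>
          (\<exists>x\<in>V. (\<lambda>n. q (s n - x)) \<longlonglongrightarrow> 0))"

definition linear_between ::
  "(complex \<Rightarrow> 'b::ab_group_add \<Rightarrow> 'b) \<Rightarrow> 'b set \<Rightarrow>
   (complex \<Rightarrow> 'c::ab_group_add \<Rightarrow> 'c) \<Rightarrow> 'c set \<Rightarrow> ('b \<Rightarrow> 'c) \<Rightarrow> bool" where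
  "linear_between s1 V1 s2 V2 T \<longleftrightarrow> T ` V1 \<subseteq> V2 \<and>
     (\<forall>x\<in>V1. \<forall>y\<in>V1. T (x + y) = T x + T y) \<and> (\<forall>c. \<forall>x\<in>V1. T (s1 c x) = s2 c (T x))"

definition isomorphic_spaces ::
  "(complex \<Rightarrow> 'b::ab_group_add \<Rightarrow> 'b) \<Rightarrow> 'b set \<Rightarrow> ('b \<Rightarrow> real) \<Rightarrow>
   (complex \<Rightarrow> 'c::ab_group_add \<Rightarrow> 'c) \<Rightarrow> 'c set \<Rightarrow> ('c \<Rightarrow> real) \<Rightarrow> bool" where
  "isomorphic_spaces s1 V1 q1 s2 V2 q2 \<longleftrightarrow>
     (\<exists>T. linear_between s1 V1 s2 V2 T \<and> bij_betw T V1 V2 \<and>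
        (\<exists>A>0. \<exists>B>0. \<forall>x\<in>V1. A * q1 x \<le> q2 (T x) \<and> q2 (T x) \<le> B * q1 x))"

definition is_completion ::
  "(complex \<Rightarrow> 'b::ab_group_add \<Rightarrow> 'b) \<Rightarrow> 'b set \<Rightarrow> ('b \<Rightarrow> real) \<Rightarrow>
   (complex \<Rightarrow> 'c::ab_group_add \<Rightarrow> 'c) \<Rightarrow> 'c set \<Rightarrow> ('c \<Rightarrow> real) \<Rightarrow> ('b \<Rightarrow> 'c) \<Rightarrow> bool" where
  "is_completion s1 V1 q1 s2 V2 q2 \<iota> \<longleftrightarrow>
     quasi_normed_space s2 V2 q2 \<and> q_complete V2 q2 \<and>
     linear_between s1 V1 s2 V2 \<iota> \<and> (\<forall>x\<in>V1. q2 (\<iota> x) = q1 x) \<and>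
     (\<forall>y\<in>V2. \<forall>\<epsilon>>0. \<exists>x\<in>V1. q2 (y - \<iota> x) < \<epsilon>)"


section \<open>Twisted spreading models\<close>

definition normalized_consecutive_blocks :: "(nat \<Rightarrow> cseq) \<Rightarrow> bool" where
  "normalized_consecutive_blocks u \<longleftrightarrow>
     (\<forall>j. u j \<in> c00 \<and> l2_norm (u j) = 1 \<and> block_less (u j) (u (Suc j)))"

text \<open>\<open>L\<close> is the limit of \<open>f k\<close> as \<open>\<nu> \<rightarrow> \<infinity>\<close>, \<open>\<nu> < k 0 < \<dots> < k (n - 1)\<close>.\<close>

definition spreading_limit :: "nat \<Rightarrow> ((nat \<Rightarrow> nat) \<Rightarrow> real) \<Rightarrow> real \<Rightarrow> bool" where
  "spreading_limit n f L \<longleftrightarrow>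
     (\<forall>\<epsilon>>0. \<exists>\<nu>. \<forall>k. strict_mono_on {..<n} k \<and> (\<forall>j<n. \<nu> < k j) \<longrightarrow> \<bar>f k - L\<bar> < \<epsilon>)"

text \<open>The limit is taken of the norms, in the twisted space of \<open>\<Omega>\<close>, of the vectors
  \<open>\<Sum>j<n. a j (u (k j), 0) + \<Sum>j<n. b j (\<Omega> (u (k j)), u (k j))\<close>.\<close>

definition spreading_quasi_norm ::
  "(cseq \<Rightarrow> cseq) \<Rightarrow> (nat \<Rightarrow> cseq) \<Rightarrow> (cseq \<times> cseq \<Rightarrow> real) \<Rightarrow> bool" where
  "spreading_quasi_norm \<Omega> u q \<longleftrightarrow>
     (\<forall>n a b. spreading_limit n
        (\<lambda>k. twisted_norm \<Omega>
           ((\<Sum>j<n. seq_scale (a j) (u (k j))) + (\<Sum>j<n. seq_scale (b j) (\<Omega> (u (k j)))),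
            \<Sum>j<n. seq_scale (b j) (u (k j))))
        (q (truncate n a, truncate n b)))"

definition twisted_spreading_model ::
  "(cseq \<Rightarrow> cseq) \<Rightarrow> (complex \<Rightarrow> 'b::ab_group_add \<Rightarrow> 'b) \<Rightarrow> 'b set \<Rightarrow> ('b \<Rightarrow> real) \<Rightarrow> bool" where
  "twisted_spreading_model \<Omega> s V Q \<longleftrightarrow>
     (\<exists>u q \<iota>. normalized_consecutive_blocks u \<and> spreading_quasi_norm \<Omega> u q \<and>
        is_completion seq2_scale (c00 \<times> c00) q s V Q \<iota>)"

end

theory Submission
  imports Defs
begin

text \<open>Let \<open>u\<^sub>1 < \<dots> < u\<^sub>n\<close> be far out normalized blocks with factorizations
  \<open>|u\<^sub>j|\<^sup>2 = |v\<^sub>j| |w\<^sub>j|\<close>, and let \<open>y = \<Sum> b\<^sub>j u\<^sub>j\<close> with \<open>\<Sum> |b\<^sub>j|\<^sup>2 = 1\<close>. In an asymptotic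
  \<open>l\<^sub>p\<close>-space the pair \<open>v' = \<Sum> |b\<^sub>j| powr (2 / p) v\<^sub>j\<close>, \<open>w' = \<Sum> |b\<^sub>j| powr (2 - 2 / p) w\<^sub>j\<close>
  factorizes \<open>|y|\<^sup>2\<close>, with norms bounded by a constant. It need not be the factorization \<open>(v, w)\<close> selected for \<open>y\<close>,
  but with \<open>r = |v'| / |v|\<close> duality bounds \<open>\<Sum> |y|\<^sup>2 r = \<Sum> |w| |v'|\<close> and
  \<open>\<Sum> |y|\<^sup>2 / r = \<Sum> |w'| |v|\<close>, hence \<open>\<Sum> |y|\<^sup>2 (ln r)\<^sup>2\<close>. So \<open>\<Omega> y\<close> may be computed from
  \<open>(v', w')\<close> up to a bounded error in \<open>l\<^sub>2\<close>, which gives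
  \<open>\<Omega> y \<approx> \<Sum> b\<^sub>j \<Omega> u\<^sub>j + (2 - 4 / p) \<Sum> b\<^sub>j ln |b\<^sub>j| u\<^sub>j\<close>. For \<open>p \<noteq> 2\<close> the map
  \<open>(a, b) \<mapsto> (a / (2 - 4 / p), b)\<close> is therefore an isomorphism of \<open>c\<^sub>0\<^sub>0 \<times> c\<^sub>0\<^sub>0\<close> onto a dense
  subspace of the Kalton-Peck space, and it extends to the completions.\<close>


section \<open>Square-summable sequences\<close>

text \<open>No formula expresses the factorization selected for y through those of the blocks; only
  the normalization of its two factors is used. The asymptotic hypothesis speaks of X alone, and no
  estimate for blocks of the dual is derived from it. The pairing of v' with w uses the upper
  estimate for v'. The pairing of w' with v is bounded without a dual norm of w': v is cut along the
  blocks, duality is applied on each piece, and Hoelder's inequality together with the lower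
  estimate for v finishes; this includes p = 1. All constants must be independent of n, which is
  possible since n blocks are taken beyond n, and a spreading limit only sees such blocks. The
  coefficient 2 - 4/p is twice the difference of the exponents 1 - 1/p and 1/p that |b_j|^2 receives
  in w' and v', so it vanishes exactly for p = 2. Quasi-norms need not be continuous, so the
  extension to the completions is built as a relation of common approximation, with triangle
  constants entering its bounds.\<close>

lemma sum_fun_apply: "(\<Sum>i\<in>A. f i) x = (\<Sum>i\<in>A. f i x)"
  for f :: "'a \<Rightarrow> 'b \<Rightarrow> 'c::comm_monoid_add"
  by (induction A rule: infinite_finite_induct) auto

lemma seq_scale_apply [simp]: "seq_scale c x j = c * x j"
  by (simp add: seq_scale_def)

lemma vector_space_seq2: "vector_space seq2_scale"
  by unfold_locales (auto simp: seq2_scale_def seq_scale_def fun_eq_iff algebra_simps)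

lemma in_c00_iff: "x \<in> c00 \<longleftrightarrow> (\<exists>n. \<forall>j\<ge>n. x j = 0)"
proof
  assume "x \<in> c00"
  then have "finite {j. x j \<noteq> 0}" by (simp add: c00_def supp_def)
  then show "\<exists>n. \<forall>j\<ge>n. x j = 0"
    unfolding finite_nat_set_iff_bounded by (metis mem_Collect_eq not_less)
next
  assume "\<exists>n. \<forall>j\<ge>n. x j = 0"
  then obtain n where "\<forall>j\<ge>n. x j = 0" by blast
  then have "supp x \<subseteq> {..<n}" by (auto simp: supp_def not_less[symmetric])
  then show "x \<in> c00" unfolding c00_def by (auto intro: finite_subset)
qed

lemma c00_add: "x \<in> c00 \<Longrightarrow> y \<in> c00 \<Longrightarrow> x + y \<in> c00"
  unfolding c00_def supp_def
  by (auto intro: finite_subset[of _ "{j. x j \<noteq> 0} \<union> {j. y j \<noteq> 0}"])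

lemma c00_scale: "x \<in> c00 \<Longrightarrow> seq_scale c x \<in> c00"
  unfolding in_c00_iff by auto

lemma c00_zero: "0 \<in> c00"
  unfolding in_c00_iff by auto

lemma c00_sum: "(\<And>i. i \<in> A \<Longrightarrow> f i \<in> c00) \<Longrightarrow> (\<Sum>i\<in>A. f i) \<in> c00"
  by (induction A rule: infinite_finite_induct) (auto simp: c00_zero c00_add)

lemma truncate_c00: "truncate n a \<in> c00"
  unfolding in_c00_iff truncate_def by (rule exI[of _ n]) auto

lemma L2_set_le_l2_norm:
  assumes "x \<in> l2" "finite A"
  shows "L2_set (\<lambda>j. cmod (x j)) A \<le> l2_norm x"
  unfolding L2_set_def l2_norm_def
  using assms by (auto intro!: sum_le_suminf simp: l2_def)

text \<open>Membership and bound come together because \<open>l2_norm\<close> has no meaning for a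
  divergent series; later estimates have to provide both. Working with \<open>L2_set\<close> on
  initial segments gives access to Minkowski's inequality.\<close>

lemma l2_bound:
  assumes "\<And>n. L2_set (\<lambda>j. cmod (x j)) {..<n} \<le> M"
  shows "x \<in> l2" "l2_norm x \<le> M"
proof -
  have M: "0 \<le> M" using assms[of 0] by simp
  have b: "(\<Sum>j<n. (cmod (x j))\<^sup>2) \<le> M\<^sup>2" for n
    using assms[of n] unfolding L2_set_def by (meson sqrt_le_D)
  have s: "summable (\<lambda>j. (cmod (x j))\<^sup>2)"
    by (rule summableI_nonneg_bounded[OF _ b]) auto
  then show "x \<in> l2" by (simp add: l2_def)
  have "(\<Sum>j. (cmod (x j))\<^sup>2) \<le> M\<^sup>2"
    by (rule suminf_le_const[OF s b])
  then show "l2_norm x \<le> M" unfolding l2_norm_def using M by (simp add: real_le_lsqrt)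
qed

lemma l2_norm_nonneg [simp]: "x \<in> l2 \<Longrightarrow> 0 \<le> l2_norm x"
  unfolding l2_norm_def l2_def by (auto intro!: suminf_nonneg)

lemma l2_norm_zero [simp]: "l2_norm 0 = 0"
  by (simp add: l2_norm_def)

lemma l2_dominated:
  assumes "y \<in> l2" "\<And>j. cmod (x j) \<le> C * cmod (y j)" "0 \<le> C"
  shows "x \<in> l2" "l2_norm x \<le> C * l2_norm y"
proof -
  have "L2_set (\<lambda>j. cmod (x j)) {..<n} \<le> C * l2_norm y" for n
  proof -
    have "L2_set (\<lambda>j. cmod (x j)) {..<n} \<le> L2_set (\<lambda>j. C * cmod (y j)) {..<n}"
      using assms by (intro L2_set_mono) auto
    also have "\<dots> = C * L2_set (\<lambda>j. cmod (y j)) {..<n}"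
      using assms by (simp add: L2_set_right_distrib)
    also have "\<dots> \<le> C * l2_norm y"
      using assms by (intro mult_left_mono L2_set_le_l2_norm) auto
    finally show ?thesis .
  qed
  from l2_bound[OF this] show "x \<in> l2" "l2_norm x \<le> C * l2_norm y" by auto
qed

lemma l2_add:
  assumes "x \<in> l2" "y \<in> l2"
  shows "x + y \<in> l2" "l2_norm (x + y) \<le> l2_norm x + l2_norm y"
proof -
  have "L2_set (\<lambda>j. cmod ((x + y) j)) {..<n} \<le> l2_norm x + l2_norm y" for n :: nat
  proof -
    have "L2_set (\<lambda>j. cmod ((x + y) j)) {..<n} \<le> L2_set (\<lambda>j. cmod (x j) + cmod (y j)) {..<n}"
      by (intro L2_set_mono) (auto intro: norm_triangle_ineq)
    also have "\<dots> \<le> L2_set (\<lambda>j. cmod (x j)) {..<n} + L2_set (\<lambda>j. cmod (y j)) {..<n}"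
      by (rule L2_set_triangle_ineq)
    also have "\<dots> \<le> l2_norm x + l2_norm y"
      using assms by (intro add_mono L2_set_le_l2_norm) auto
    finally show ?thesis .
  qed
  from l2_bound[OF this] show "x + y \<in> l2" "l2_norm (x + y) \<le> l2_norm x + l2_norm y" .
qed

lemma l2_scale: "x \<in> l2 \<Longrightarrow> seq_scale c x \<in> l2"
  by (rule l2_dominated(1)[of x _ "cmod c"]) (auto simp: norm_mult)

lemma l2_norm_scale: "x \<in> l2 \<Longrightarrow> l2_norm (seq_scale c x) = cmod c * l2_norm x"
  unfolding l2_norm_def l2_def
  by (simp add: norm_mult power_mult_distrib suminf_mult real_sqrt_mult)

lemma l2_minus: "x \<in> l2 \<Longrightarrow> - x \<in> l2" "l2_norm (- x) = l2_norm x"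
  by (simp_all add: l2_def l2_norm_def)

lemma l2_diff:
  assumes "x \<in> l2" "y \<in> l2"
  shows "x - y \<in> l2" "l2_norm (x - y) \<le> l2_norm x + l2_norm y"
  using l2_add[of x "- y"] l2_minus[of y] assms by simp_all

lemma cmod_le_l2_norm: "x \<in> l2 \<Longrightarrow> cmod (x j) \<le> l2_norm x"
  using L2_set_le_l2_norm[of x "{j}"] by simp

lemma l2_norm_eq_0: "x \<in> l2 \<Longrightarrow> l2_norm x = 0 \<longleftrightarrow> x = 0"
proof
  assume "x \<in> l2" "l2_norm x = 0"
  then show "x = 0" using cmod_le_l2_norm[of x] by (simp add: fun_eq_iff)
qed (simp)

lemma l2_norm_finite:
  assumes "finite A" "\<And>j. j \<notin> A \<Longrightarrow> x j = 0"
  shows "l2_norm x = L2_set (\<lambda>j. cmod (x j)) A"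
  unfolding l2_norm_def L2_set_def using assms by (subst suminf_finite) auto

lemma c00_l2: "x \<in> c00 \<Longrightarrow> x \<in> l2"
  unfolding c00_def l2_def supp_def using summable_finite[of "{j. x j \<noteq> 0}" "\<lambda>j. (cmod (x j))\<^sup>2"] by simp

lemma zero_l2 [simp]: "0 \<in> l2"
  by (simp add: c00_l2 c00_zero)

text \<open>Fatou property of the norm, read off from finite segments; it turns coordinatewise
  limits into norm estimates in the completeness proof.\<close>

lemma tendsto_l2_norm_le:
  assumes "\<And>n. n \<ge> M \<Longrightarrow> x n \<in> l2" "\<And>n. n \<ge> M \<Longrightarrow> l2_norm (x n) \<le> C" "\<And>j. (\<lambda>n. x n j) \<longlonglongrightarrow> y j"
  shows "y \<in> l2" "l2_norm y \<le> C"
proof -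
  have "L2_set (\<lambda>j. cmod (y j)) {..<k} \<le> C" for k
  proof (rule tendsto_upperbound)
    show "(\<lambda>n. L2_set (\<lambda>j. cmod (x n j)) {..<k}) \<longlonglongrightarrow> L2_set (\<lambda>j. cmod (y j)) {..<k}"
      unfolding L2_set_def using assms(3) by (intro tendsto_intros) auto
    show "\<forall>\<^sub>F n in sequentially. L2_set (\<lambda>j. cmod (x n j)) {..<k} \<le> C"
      using assms(1,2) L2_set_le_l2_norm
      by (intro eventually_sequentiallyI[of M]) (meson finite_lessThan order_trans)
  qed simp
  from l2_bound[OF this] show "y \<in> l2" "l2_norm y \<le> C" by auto
qed


section \<open>The Kalton-Peck space\<close>

text \<open>Both cases come from ln t <= t - 1, with t = m / x or t = x / m. The range extends to 2
  m because m will be the maximum of two quantities and the bound is also applied to their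
  sum.\<close>

lemma x_ln_bound:
  fixes x m :: real
  assumes "0 \<le> x" "x \<le> 2 * m"
  shows "x * \<bar>ln (x / m)\<bar> \<le> 2 * m"
proof (cases "x = 0")
  case True
  then show ?thesis using assms by simp
next
  case False
  then have x: "0 < x" and m: "0 < m" using assms by auto
  show ?thesis
  proof (cases "x \<le> m")
    case True
    have "\<bar>ln (x / m)\<bar> = ln (m / x)"
      using True x m by (simp add: ln_div)
    also have "\<dots> \<le> m / x - 1" using x m by (intro ln_le_minus_one) auto
    finally have "x * \<bar>ln (x / m)\<bar> \<le> x * (m / x - 1)" using x by (intro mult_left_mono) auto
    then show ?thesis using x m by (simp add: algebra_simps)
  next
    case False
    have "\<bar>ln (x / m)\<bar> = ln (x / m)"
      using False x m by (simp add: ln_div)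
    also have "\<dots> \<le> x / m - 1" using x m by (intro ln_le_minus_one) auto
    also have "\<dots> \<le> 1" using x m assms by (simp add: field_simps)
    finally have "x * \<bar>ln (x / m)\<bar> \<le> x * 1" using x by (intro mult_left_mono) auto
    then show ?thesis using assms by simp
  qed
qed

text \<open>A coordinate of the Kalton-Peck map with free normalization \<open>r\<close>. Changing
  \<open>r\<close> adds a term linear in \<open>z\<close>, so \<open>r\<close> can be chosen at will
  inside additive defects.\<close>

definition zlog :: "complex \<Rightarrow> real \<Rightarrow> complex" where
  "zlog z r = z * complex_of_real (ln (cmod z / r))"

lemma zlog_diff: "0 < m \<Longrightarrow> zlog z 1 = zlog z m + z * complex_of_real (ln m)"
  by (cases "z = 0") (auto simp: zlog_def ln_div algebra_simps)

lemma cmod_zlog_le: "cmod z \<le> 2 * m \<Longrightarrow> cmod (zlog z m) \<le> 2 * m"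
  using x_ln_bound[of "cmod z" m] by (simp add: zlog_def norm_mult)

text \<open>The defect does not change when the logarithms are rescaled by m = max(|s|, |t|), and at
  this scale each of the three terms is at most 2 m.\<close>

lemma zlog_quasi_additive:
  "cmod (zlog s 1 + zlog t 1 - zlog (s + t) 1) \<le> 6 * (cmod s + cmod t)"
proof (cases "s = 0 \<and> t = 0")
  case True
  then show ?thesis by (simp add: zlog_def)
next
  case False
  define m where "m = max (cmod s) (cmod t)"
  have m: "0 < m" using False by (auto simp: m_def less_max_iff_disj)
  have st: "cmod s \<le> m" "cmod t \<le> m" by (auto simp: m_def)
  have eq: "zlog s 1 + zlog t 1 - zlog (s + t) 1 = zlog s m + zlog t m - zlog (s + t) m"
    by (simp add: zlog_diff[OF m] algebra_simps)
  have "cmod (zlog s m + zlog t m - zlog (s + t) m)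
      \<le> cmod (zlog s m) + cmod (zlog t m) + cmod (zlog (s + t) m)"
    by (meson add_mono norm_triangle_ineq norm_triangle_ineq4 order_refl order_trans)
  also have "\<dots> \<le> 2 * m + 2 * m + 2 * m"
    using st m norm_triangle_ineq[of s t] by (intro add_mono cmod_zlog_le) auto
  also have "\<dots> \<le> 6 * (cmod s + cmod t)"
    by (auto simp: m_def max_def)
  finally show ?thesis unfolding eq .
qed

lemma kalton_peck_zlog: "kalton_peck_map y j = zlog (y j) (l2_norm y)"
  by (simp add: kalton_peck_map_def zlog_def)

text \<open>Separates the coordinatewise function from the dependence on the norm; quasi-linearity
  and continuity are then treated for each part by itself.\<close>

lemma kalton_peck_split:
  assumes "y \<in> l2"
  shows "kalton_peck_map y j = zlog (y j) 1 - y j * complex_of_real (ln (l2_norm y))"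
proof (cases "y j = 0")
  case False
  then have "0 < l2_norm y" using cmod_le_l2_norm[OF assms, of j]
    by (metis norm_le_zero_iff order_less_le_trans zero_less_norm_iff)
  from zlog_diff[OF this] show ?thesis by (simp add: kalton_peck_zlog)
qed (simp add: kalton_peck_zlog zlog_def)

lemma kalton_peck_zero [simp]: "kalton_peck_map 0 = 0"
  by (simp add: kalton_peck_map_def fun_eq_iff)

lemma kalton_peck_scale:
  assumes "y \<in> l2"
  shows "kalton_peck_map (seq_scale c y) = seq_scale c (kalton_peck_map y)"
proof (cases "c = 0")
  case True
  have "seq_scale 0 z = 0" for z by (simp add: fun_eq_iff)
  then show ?thesis using True by simp
next
  case False
  then show ?thesis
    by (simp add: kalton_peck_map_def l2_norm_scale[OF assms] fun_eq_iff norm_mult)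
qed

lemma cmod_kalton_peck_le: "y \<in> l2 \<Longrightarrow> cmod (kalton_peck_map y j) \<le> 2 * l2_norm y"
  unfolding kalton_peck_zlog using cmod_le_l2_norm[of y j] l2_norm_nonneg[of y]
  by (intro cmod_zlog_le) linarith

text \<open>The defect is f - g, where f is the coordinatewise defect and g collects the logarithms
  of the three norms. Each of the two contributes 6 (||x|| + ||y||), hence the constant 12.\<close>

lemma kalton_peck_quasilinear:
  assumes "x \<in> l2" "y \<in> l2"
  shows "kalton_peck_map x + kalton_peck_map y - kalton_peck_map (x + y) \<in> l2"
    and "l2_norm (kalton_peck_map x + kalton_peck_map y - kalton_peck_map (x + y))
      \<le> 12 * (l2_norm x + l2_norm y)"
proof -
  define X Y W where "X = l2_norm x" and "Y = l2_norm y" and "W = l2_norm (x + y)"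
  have xy: "x + y \<in> l2" and W: "W \<le> X + Y" using l2_add[OF assms] by (auto simp: X_def Y_def W_def)
  have nn: "0 \<le> X" "0 \<le> Y" "0 \<le> W" using assms xy by (auto simp: X_def Y_def W_def)
  define ax ay where "ax = (\<lambda>j. complex_of_real (cmod (x j)))" and "ay = (\<lambda>j. complex_of_real (cmod (y j)))"
  have ax: "ax \<in> l2" "l2_norm ax \<le> X" using l2_dominated[OF assms(1), of ax 1] by (auto simp: ax_def X_def)
  have ay: "ay \<in> l2" "l2_norm ay \<le> Y" using l2_dominated[OF assms(2), of ay 1] by (auto simp: ay_def Y_def)
  define f g where "f = (\<lambda>j. zlog (x j) 1 + zlog (y j) 1 - zlog (x j + y j) 1)"
    and "g = (\<lambda>j. x j * complex_of_real (ln X) + y j * complex_of_real (ln Y)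
           - (x j + y j) * complex_of_real (ln W))"
  have eq: "kalton_peck_map x + kalton_peck_map y - kalton_peck_map (x + y) = f - g"
    using assms xy by (simp add: fun_eq_iff kalton_peck_split f_def g_def X_def Y_def W_def algebra_simps)
  have axy: "ax + ay \<in> l2" "l2_norm (ax + ay) \<le> X + Y"
    using l2_add[OF ax(1) ay(1)] ax ay by auto
  have fb: "cmod (f j) \<le> 6 * cmod ((ax + ay) j)" for j
  proof -
    have "cmod ((ax + ay) j) = cmod (x j) + cmod (y j)"
      unfolding ax_def ay_def plus_fun_apply of_real_add[symmetric] norm_of_real by simp
    then show ?thesis unfolding f_def using zlog_quasi_additive[of "x j" "y j"] by simp
  qed
  have f: "f \<in> l2" "l2_norm f \<le> 6 * (X + Y)"
    using l2_dominated[of "ax + ay" f 6, OF axy(1) fb] axy(2) by simp_all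
  have g: "g \<in> l2 \<and> l2_norm g \<le> 6 * (X + Y)"
  proof (cases "X = 0 \<and> Y = 0")
    case True
    then have "x = 0" "y = 0" using assms by (auto simp: X_def Y_def l2_norm_eq_0)
    then have "g = 0" by (simp add: g_def fun_eq_iff)
    then show ?thesis using nn by simp
  next
    case False
    define m where "m = max X Y"
    have m: "0 < m" using False nn by (auto simp: m_def max_def)
    \<comment> \<open>The rescaling used for \<open>zlog\<close>, now at the level of norms: the
      multiples of ln m cancel in g, and what remains has norm at most 2 m for each vector.\<close>
    define L where "L z r = seq_scale (complex_of_real (ln (r / m))) z" for z r
    have L: "L z (l2_norm z) \<in> l2" "l2_norm (L z (l2_norm z)) \<le> 2 * m"
      if "z \<in> l2" "l2_norm z \<le> 2 * m" for z
      using that x_ln_bound[of "l2_norm z" m]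
      by (auto simp: L_def l2_scale l2_norm_scale mult.commute)
    have LL: "z j * complex_of_real (ln (l2_norm z)) = L z (l2_norm z) j + z j * complex_of_real (ln m)"
      if "z \<in> l2" for z j
    proof (cases "l2_norm z = 0")
      case True
      then show ?thesis using that by (simp add: l2_norm_eq_0 L_def)
    next
      case False
      then have "0 < l2_norm z" using l2_norm_nonneg[OF that] by linarith
      then show ?thesis using m by (simp add: L_def ln_div algebra_simps)
    qed
    have "g j = (L x X + L y Y - L (x + y) W) j" for j
      using LL[OF assms(1), of j] LL[OF assms(2), of j] LL[OF xy, of j]
      unfolding g_def X_def Y_def W_def by (simp add: algebra_simps)
    then have geq: "g = L x X + L y Y - L (x + y) W" by (simp add: fun_eq_iff)
    have b: "X \<le> 2 * m" "Y \<le> 2 * m" "W \<le> 2 * m" using W m by (auto simp: m_def)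
    note Lx = L[OF assms(1) b(1)[unfolded X_def], folded X_def]
      and Ly = L[OF assms(2) b(2)[unfolded Y_def], folded Y_def]
      and Lw = L[OF xy b(3)[unfolded W_def], folded W_def]
    note s1 = l2_add[OF Lx(1) Ly(1)]
    note s2 = l2_diff[OF s1(1) Lw(1)]
    have "m \<le> X + Y" using nn by (auto simp: m_def)
    then show ?thesis unfolding geq using s2 s1(2) Lx(2) Ly(2) Lw(2) by auto
  qed
  show "kalton_peck_map x + kalton_peck_map y - kalton_peck_map (x + y) \<in> l2"
    "l2_norm (kalton_peck_map x + kalton_peck_map y - kalton_peck_map (x + y))
      \<le> 12 * (l2_norm x + l2_norm y)"
    unfolding eq using l2_diff[OF f(1), of g] g f(2) by (auto simp: X_def Y_def)
qed

section \<open>Quasi-norm and coordinate functionals of the Kalton-Peck space\<close>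

abbreviation (input) "Z2 \<equiv> twisted_space kalton_peck_map"
abbreviation (input) "Z2_norm \<equiv> twisted_norm kalton_peck_map"

lemma Z2_iff: "(x, y) \<in> Z2 \<longleftrightarrow> y \<in> l2 \<and> x - kalton_peck_map y \<in> l2"
  by (simp add: twisted_space_def)

lemma Z2_norm_eq: "Z2_norm (x, y) = l2_norm (x - kalton_peck_map y) + l2_norm y"
  by (simp add: twisted_norm_def)

lemma Z2_norm_nonneg: "p \<in> Z2 \<Longrightarrow> 0 \<le> Z2_norm p"
  by (cases p) (auto simp: Z2_iff Z2_norm_eq)

text \<open>The constant is 12 from the defect of the Kalton-Peck map plus 1 from the norm of the
  second coordinate.\<close>

lemma Z2_add:
  assumes "p \<in> Z2" "p' \<in> Z2"
  shows "p + p' \<in> Z2" "Z2_norm (p + p') \<le> 13 * (Z2_norm p + Z2_norm p')"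
proof -
  obtain x y x' y' where p: "p = (x, y)" "p' = (x', y')" by (cases p, cases p')
  have y: "y \<in> l2" "y' \<in> l2" "x - kalton_peck_map y \<in> l2" "x' - kalton_peck_map y' \<in> l2"
    using assms by (auto simp: p Z2_iff)
  have eq: "x + x' - kalton_peck_map (y + y') = (x - kalton_peck_map y) + (x' - kalton_peck_map y')
    + (kalton_peck_map y + kalton_peck_map y' - kalton_peck_map (y + y'))"
    by (simp add: algebra_simps)
  note q = kalton_peck_quasilinear[OF y(1,2)]
  note s = l2_add[OF y(3,4)]
  note t = l2_add[OF s(1) q(1)]
  note u = l2_add[OF y(1,2)]
  show "p + p' \<in> Z2" using t(1) u(1) by (simp add: p Z2_iff eq)
  have "0 \<le> l2_norm (x - kalton_peck_map y)" "0 \<le> l2_norm (x' - kalton_peck_map y')"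
    using y by auto
  then show "Z2_norm (p + p') \<le> 13 * (Z2_norm p + Z2_norm p')"
    using t(2) s(2) q(2) u(2) by (simp add: p Z2_norm_eq eq)
qed

lemma Z2_scale:
  assumes "p \<in> Z2"
  shows "seq2_scale c p \<in> Z2" "Z2_norm (seq2_scale c p) = cmod c * Z2_norm p"
proof -
  obtain x y where p: "p = (x, y)" by (cases p)
  have y: "y \<in> l2" "x - kalton_peck_map y \<in> l2" using assms by (auto simp: p Z2_iff)
  have eq: "seq_scale c x - kalton_peck_map (seq_scale c y) = seq_scale c (x - kalton_peck_map y)"
    by (simp add: kalton_peck_scale[OF y(1)] fun_eq_iff algebra_simps)
  show "seq2_scale c p \<in> Z2" "Z2_norm (seq2_scale c p) = cmod c * Z2_norm p"
    using y by (auto simp: p seq2_scale_def Z2_iff Z2_norm_eq eq l2_scale l2_norm_scale algebra_simps)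
qed

lemma Z2_diff:
  assumes "p \<in> Z2" "p' \<in> Z2"
  shows "p - p' \<in> Z2"
proof -
  have "p - p' = p + seq2_scale (-1) p'"
    by (cases p, cases p') (simp add: seq2_scale_def fun_eq_iff)
  then show ?thesis using Z2_add(1)[OF assms(1) Z2_scale(1)[OF assms(2), of "-1"]] by metis
qed

lemma quasi_normed_space_Z2: "quasi_normed_space seq2_scale Z2 Z2_norm"
proof -
  interpret vector_space seq2_scale by (rule vector_space_seq2)
  show ?thesis
  proof
    show "subspace Z2"
      by (rule subspaceI) (auto simp: zero_prod_def Z2_iff intro: Z2_add Z2_scale)
    show "0 \<le> Z2_norm x" if "x \<in> Z2" for x using Z2_norm_nonneg[OF that] .
    show "Z2_norm x = 0 \<longleftrightarrow> x = 0" if xZ: "x \<in> Z2" for x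
    proof (cases x)
      case (Pair a b)
      have ab: "b \<in> l2" "a - kalton_peck_map b \<in> l2" using xZ by (auto simp: Pair Z2_iff)
      then have "Z2_norm x = 0 \<longleftrightarrow> l2_norm (a - kalton_peck_map b) = 0 \<and> l2_norm b = 0"
        using l2_norm_nonneg[OF ab(1)] l2_norm_nonneg[OF ab(2)] unfolding Pair Z2_norm_eq by linarith
      also have "\<dots> \<longleftrightarrow> a - kalton_peck_map b = 0 \<and> b = 0"
        using ab by (simp add: l2_norm_eq_0)
      also have "\<dots> \<longleftrightarrow> x = 0" by (auto simp: Pair zero_prod_def)
      finally show ?thesis .
    qed
    show "Z2_norm (seq2_scale c x) = cmod c * Z2_norm x" if "x \<in> Z2" for c x
      using Z2_scale(2)[OF that] .
    show "\<exists>K. \<forall>x\<in>Z2. \<forall>y\<in>Z2. Z2_norm (x + y) \<le> K * (Z2_norm x + Z2_norm y)"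
      using Z2_add(2) by blast
  qed
qed

text \<open>Coordinate functionals are continuous on \<open>Z2\<close> although \<open>x\<close>
  need not lie in \<open>l2\<close>. This provides the candidate limit of a Cauchy sequence.\<close>

lemma Z2_coordinate_bound:
  assumes "(x, y) \<in> Z2"
  shows "cmod (x j) \<le> 2 * Z2_norm (x, y)" "cmod (y j) \<le> Z2_norm (x, y)"
proof -
  have y: "y \<in> l2" "x - kalton_peck_map y \<in> l2" using assms by (auto simp: Z2_iff)
  have "cmod (x j) \<le> cmod ((x - kalton_peck_map y) j) + cmod (kalton_peck_map y j)"
    using norm_triangle_ineq[of "(x - kalton_peck_map y) j" "kalton_peck_map y j"] by simp
  also have "\<dots> \<le> l2_norm (x - kalton_peck_map y) + 2 * l2_norm y"
    by (intro add_mono cmod_le_l2_norm cmod_kalton_peck_le y)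
  also have "\<dots> \<le> 2 * Z2_norm (x, y)" using l2_norm_nonneg[OF y(2)] by (simp add: Z2_norm_eq)
  finally show "cmod (x j) \<le> 2 * Z2_norm (x, y)" .
  show "cmod (y j) \<le> Z2_norm (x, y)"
    using cmod_le_l2_norm[OF y(1), of j] l2_norm_nonneg[OF y(2)] by (simp add: Z2_norm_eq)
qed

section \<open>Coordinatewise continuity, completeness, and density of finitely supported
  pairs\<close>

lemma tendsto_mult_ln_0:
  assumes "(f \<longlongrightarrow> (0::real)) F" "\<And>n. 0 \<le> f n"
  shows "((\<lambda>n. f n * ln (f n)) \<longlongrightarrow> 0) F"
proof (rule Lim_null_comparison)
  have "(f \<longlongrightarrow> 0) F" by fact
  then have "\<forall>\<^sub>F n in F. f n < 1" by (rule order_tendstoD) simp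
  then show "\<forall>\<^sub>F n in F. norm (f n * ln (f n)) \<le> 4 * sqrt (f n)"
  proof eventually_elim
    case (elim n)
    \<comment> \<open>With f n = r^2 the product is 2 r (2 r ln r) / 2, and r |ln r| stays below 2
      for r <= 1, which gives 4 r.\<close>
    define r where "r = sqrt (f n)"
    have r: "0 \<le> r" "r \<le> 1" "f n = r\<^sup>2" using elim assms(2)[of n] by (auto simp: r_def)
    have "\<bar>f n * ln (f n)\<bar> = 2 * r * (r * \<bar>ln r\<bar>)"
    proof (cases "r = 0")
      case False
      then show ?thesis using r by (simp add: r(3) ln_realpow power2_eq_square abs_mult ln_mult)
    qed (simp add: r(3))
    also have "\<dots> \<le> 2 * r * 2"
      using x_ln_bound[of r 1] r by (intro mult_left_mono) auto
    finally show ?case by (simp add: r_def)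
  qed
  show "((\<lambda>n. 4 * sqrt (f n)) \<longlongrightarrow> 0) F"
    using tendsto_mult[OF tendsto_const[of 4] tendsto_real_sqrt[OF assms(1)]] by simp
qed

lemma tendsto_zlog:
  assumes "(f \<longlongrightarrow> z) F"
  shows "((\<lambda>n. zlog (f n) 1) \<longlongrightarrow> zlog z 1) F"
proof (cases "z = 0")
  case True
  have "((\<lambda>n. cmod (f n) * ln (cmod (f n))) \<longlongrightarrow> 0) F"
    using assms True by (intro tendsto_mult_ln_0) (auto intro: tendsto_norm_zero)
  then have "((\<lambda>n. norm (zlog (f n) 1)) \<longlongrightarrow> 0) F"
    by (simp add: zlog_def norm_mult tendsto_rabs_zero_iff[of "\<lambda>n. cmod (f n) * ln (cmod (f n))", symmetric] abs_mult)
  then show ?thesis using True by (simp add: tendsto_norm_zero_iff zlog_def)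
next
  case False
  then show ?thesis unfolding zlog_def using assms by (intro tendsto_intros) auto
qed

text \<open>The map depends on the norm of its argument, so coordinatewise convergence has to be
  accompanied by convergence of the norms.\<close>

lemma tendsto_kalton_peck:
  assumes "\<And>n. y n \<in> l2" "z \<in> l2" "(\<lambda>n. y n j) \<longlonglongrightarrow> z j" "(\<lambda>n. l2_norm (y n)) \<longlonglongrightarrow> l2_norm z"
  shows "(\<lambda>n. kalton_peck_map (y n) j) \<longlonglongrightarrow> kalton_peck_map z j"
proof (cases "l2_norm z = 0")
  case True
  then have "z = 0" using assms(2) by (simp add: l2_norm_eq_0)
  have "(\<lambda>n. 2 * l2_norm (y n)) \<longlonglongrightarrow> 0"
    using tendsto_mult[OF tendsto_const[of 2] assms(4)] True by simp
  then have "(\<lambda>n. kalton_peck_map (y n) j) \<longlonglongrightarrow> 0"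
    by (rule Lim_null_comparison[rotated]) (simp add: cmod_kalton_peck_le assms(1))
  then show ?thesis using \<open>z = 0\<close> by simp
next
  case False
  show ?thesis
    unfolding kalton_peck_split[OF assms(1)] kalton_peck_split[OF assms(2)]
    using False assms by (intro tendsto_intros tendsto_zlog) auto
qed

lemma Z2_complete: "q_complete Z2 Z2_norm"
  unfolding q_complete_def
proof (intro allI impI, elim conjE)
  fix s :: "nat \<Rightarrow> cseq \<times> cseq"
  assume sZ: "\<forall>n. s n \<in> Z2" and C: "\<forall>\<epsilon>>0. \<exists>M. \<forall>m\<ge>M. \<forall>n\<ge>M. Z2_norm (s m - s n) < \<epsilon>"
  define X Y where "X n = fst (s n)" and "Y n = snd (s n)" for n
  have s: "s n = (X n, Y n)" for n by (simp add: X_def Y_def)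
  have d: "(X m - X n, Y m - Y n) \<in> Z2" for m n
    using Z2_diff[of "s m" "s n"] sZ by (simp add: s)
  have C': "\<exists>M. \<forall>m\<ge>M. \<forall>n\<ge>M. Z2_norm (X m - X n, Y m - Y n) < \<epsilon>" if "\<epsilon> > 0" for \<epsilon>
    using C that by (simp add: s)
  have "Cauchy (\<lambda>n. X n j)" for j
    unfolding Cauchy_def dist_norm
  proof (intro allI impI)
    fix \<epsilon> :: real assume "\<epsilon> > 0"
    then obtain M where M: "\<forall>m\<ge>M. \<forall>n\<ge>M. Z2_norm (X m - X n, Y m - Y n) < \<epsilon> / 2"
      using C'[of "\<epsilon> / 2"] by auto
    show "\<exists>M. \<forall>m\<ge>M. \<forall>n\<ge>M. cmod (X m j - X n j) < \<epsilon>"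
    proof (intro exI[of _ M] allI impI)
      fix m n assume "m \<ge> M" "n \<ge> M"
      with M have "Z2_norm (X m - X n, Y m - Y n) < \<epsilon> / 2" by blast
      then show "cmod (X m j - X n j) < \<epsilon>"
        using Z2_coordinate_bound(1)[OF d[of m n], of j] by simp
    qed
  qed
  then have "\<forall>j. \<exists>a. (\<lambda>n. X n j) \<longlonglongrightarrow> a"
    by (metis Cauchy_convergent convergent_def)
  then obtain x where x: "\<And>j. (\<lambda>n. X n j) \<longlonglongrightarrow> x j" by metis
  have "Cauchy (\<lambda>n. Y n j)" for j
    unfolding Cauchy_def dist_norm
  proof (intro allI impI)
    fix \<epsilon> :: real assume "\<epsilon> > 0"
    then obtain M where M: "\<forall>m\<ge>M. \<forall>n\<ge>M. Z2_norm (X m - X n, Y m - Y n) < \<epsilon>"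
      using C'[of "\<epsilon>"] by auto
    show "\<exists>M. \<forall>m\<ge>M. \<forall>n\<ge>M. cmod (Y m j - Y n j) < \<epsilon>"
    proof (intro exI[of _ M] allI impI)
      fix m n assume "m \<ge> M" "n \<ge> M"
      with M have "Z2_norm (X m - X n, Y m - Y n) < \<epsilon>" by blast
      then show "cmod (Y m j - Y n j) < \<epsilon>"
        using Z2_coordinate_bound(2)[OF d[of m n], of j] by simp
    qed
  qed
  then have "\<forall>j. \<exists>a. (\<lambda>n. Y n j) \<longlonglongrightarrow> a"
    by (metis Cauchy_convergent convergent_def)
  then obtain y where y: "\<And>j. (\<lambda>n. Y n j) \<longlonglongrightarrow> y j" by metis
  have dl: "Y m - Y n \<in> l2" "X m - X n - kalton_peck_map (Y m - Y n) \<in> l2" for m n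
    using d[of m n] by (auto simp: Z2_iff)
  have small: "l2_norm (Y m - Y n) \<le> Z2_norm (X m - X n, Y m - Y n)"
    "l2_norm (X m - X n - kalton_peck_map (Y m - Y n)) \<le> Z2_norm (X m - X n, Y m - Y n)" for m n
    using l2_norm_nonneg[OF dl(1)] l2_norm_nonneg[OF dl(2)] by (auto simp: Z2_norm_eq)
  have Yl: "Y n - y \<in> l2 \<and> l2_norm (Y n - y) \<le> \<epsilon>"
    if M: "\<forall>m\<ge>M. \<forall>n\<ge>M. Z2_norm (X m - X n, Y m - Y n) < \<epsilon>" and "n \<ge> M" for M n \<epsilon>
  proof -
    have "l2_norm (Y n - Y m) \<le> \<epsilon>" if "m \<ge> M" for m
      using M that \<open>n \<ge> M\<close> small(1)[of n m] by (meson less_imp_le order_trans)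
    moreover have "(\<lambda>m. (Y n - Y m) j) \<longlonglongrightarrow> (Y n - y) j" for j
      using y[of j] by (auto intro!: tendsto_intros)
    ultimately show ?thesis
      using tendsto_l2_norm_le[of M "\<lambda>m. Y n - Y m" \<epsilon> "Y n - y"] dl(1) by blast
  qed
  obtain M1 where M1: "\<forall>m\<ge>M1. \<forall>n\<ge>M1. Z2_norm (X m - X n, Y m - Y n) < 1" using C'[of 1] by auto
  have Yl2: "Y n \<in> l2" for n using sZ by (metis s Z2_iff)
  have yl2: "y \<in> l2"
    using l2_diff(1)[OF Yl2[of M1] conjunct1[OF Yl[OF M1 order_refl]]] by simp
  have Yn: "(\<lambda>n. l2_norm (Y n - y)) \<longlonglongrightarrow> 0"
  proof (rule LIMSEQ_I)
    fix r :: real assume "0 < r"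
    then obtain M where "\<forall>m\<ge>M. \<forall>n\<ge>M. Z2_norm (X m - X n, Y m - Y n) < r / 2" using C'[of "r / 2"] by auto
    from Yl[OF this] show "\<exists>no. \<forall>n\<ge>no. norm (l2_norm (Y n - y) - 0) < r"
      using \<open>0 < r\<close> l2_diff(1)[OF Yl2 yl2] by (intro exI[of _ M]) (force simp: abs_of_nonneg)
  qed
  \<comment> \<open>Prepares the limit in m of the Kalton-Peck map of Y n - Y m, where the norms
    have to converge too.\<close>
  have nlim: "(\<lambda>m. l2_norm (Y n - Y m)) \<longlonglongrightarrow> l2_norm (Y n - y)" for n
  proof (rule Lim_transform[OF tendsto_const])
    have dd: "Y n - y \<in> l2" for n using l2_diff(1)[OF Yl2 yl2] .
    have "norm (l2_norm (Y n - Y m) - l2_norm (Y n - y)) \<le> l2_norm (Y m - y)" for m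
    proof -
      have "Y n - Y m = (Y n - y) - (Y m - y)" "Y n - y = (Y n - Y m) + (Y m - y)" by auto
      then have "l2_norm (Y n - Y m) \<le> l2_norm (Y n - y) + l2_norm (Y m - y)"
        "l2_norm (Y n - y) \<le> l2_norm (Y n - Y m) + l2_norm (Y m - y)"
        using l2_diff(2)[OF dd dd] l2_add(2)[OF dl(1) dd] by metis+
      then show ?thesis by (simp add: abs_le_iff)
    qed
    then show "(\<lambda>m. l2_norm (Y n - Y m) - l2_norm (Y n - y)) \<longlonglongrightarrow> 0"
      by (intro Lim_null_comparison[OF always_eventually Yn] allI)
  qed
  \<comment> \<open>Letting m tend to infinity in the Cauchy estimate, each of the two summands of
    the quasi-norm keeps the bound \<epsilon> by the Fatou property.\<close>
  have lim: "s n - (x, y) \<in> Z2 \<and> Z2_norm (s n - (x, y)) \<le> 2 * \<epsilon>"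
    if M: "\<forall>m\<ge>M. \<forall>n\<ge>M. Z2_norm (X m - X n, Y m - Y n) < \<epsilon>" and "n \<ge> M" for M n \<epsilon>
  proof -
    let ?f = "\<lambda>m. X n - X m - kalton_peck_map (Y n - Y m)"
    have "l2_norm (?f m) \<le> \<epsilon>" if "m \<ge> M" for m
      using M that \<open>n \<ge> M\<close> small(2)[of n m] by (meson less_imp_le order_trans)
    moreover have "(\<lambda>m. ?f m j) \<longlonglongrightarrow> (X n - x - kalton_peck_map (Y n - y)) j" for j
    proof -
      have "(\<lambda>m. kalton_peck_map (Y n - Y m) j) \<longlonglongrightarrow> kalton_peck_map (Y n - y) j"
      proof (rule tendsto_kalton_peck)
        show "(\<lambda>m. (Y n - Y m) j) \<longlonglongrightarrow> (Y n - y) j" using y[of j] by (auto intro!: tendsto_intros)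
      qed (use dl nlim l2_diff(1)[OF Yl2 yl2] in auto)
      then show ?thesis using x[of j] by (auto intro!: tendsto_intros)
    qed
    ultimately have "X n - x - kalton_peck_map (Y n - y) \<in> l2"
      "l2_norm (X n - x - kalton_peck_map (Y n - y)) \<le> \<epsilon>"
      using tendsto_l2_norm_le[of M ?f \<epsilon>] dl(2) by blast+
    then show ?thesis using Yl[OF that] by (simp add: s Z2_iff Z2_norm_eq)
  qed
  show "\<exists>p\<in>Z2. (\<lambda>n. Z2_norm (s n - p)) \<longlonglongrightarrow> 0"
  proof (intro bexI)
    show "(\<lambda>n. Z2_norm (s n - (x, y))) \<longlonglongrightarrow> 0"
    proof (rule LIMSEQ_I)
      fix r :: real assume "0 < r"
      then obtain M where M: "\<forall>m\<ge>M. \<forall>n\<ge>M. Z2_norm (X m - X n, Y m - Y n) < r / 3" using C'[of "r / 3"] by auto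
      have "norm (Z2_norm (s n - (x, y)) - 0) < r" if "n \<ge> M" for n
        using lim[OF M that] Z2_norm_nonneg[of "s n - (x, y)"] \<open>0 < r\<close> by auto
      then show "\<exists>no. \<forall>n\<ge>no. norm (Z2_norm (s n - (x, y)) - 0) < r" by blast
    qed
    show "(x, y) \<in> Z2"
      using Z2_diff[of "s M1" "s M1 - (x, y)"] lim[OF M1 order_refl] sZ by simp
  qed
qed

text \<open>Truncating both coordinates works. The Kalton-Peck map of the tail is normalized by the
  tail norm t instead of ||y||, which costs |ln t - ln ||y||| t, and this tends to 0 because t ln t
  does.\<close>

lemma Z2_c00_dense:
  assumes "z \<in> Z2" "\<epsilon> > 0"
  shows "\<exists>p\<in>c00 \<times> c00. Z2_norm (z - p) < \<epsilon>"
proof -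
  obtain x y where z: "z = (x, y)" by (cases z)
  have y: "y \<in> l2" and x: "x - kalton_peck_map y \<in> l2" using assms by (auto simp: z Z2_iff)
  have trunc: "(\<lambda>n. l2_norm (a - truncate n a)) \<longlonglongrightarrow> 0" if "a \<in> l2" for a
  proof -
    have sm: "summable (\<lambda>j. (cmod (a j))\<^sup>2)" using that by (simp add: l2_def)
    have "l2_norm (a - truncate n a) = sqrt (\<Sum>j. (cmod (a (j + n)))\<^sup>2)" for n
    proof -
      have "a - truncate n a \<in> l2"
        using l2_diff(1)[OF that c00_l2[OF truncate_c00]] .
      then have "summable (\<lambda>j. (cmod ((a - truncate n a) j))\<^sup>2)" by (simp add: l2_def)
      then have "(\<Sum>j. (cmod ((a - truncate n a) j))\<^sup>2) = (\<Sum>j. (cmod ((a - truncate n a) (j + n)))\<^sup>2)"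
        by (subst suminf_split_initial_segment[of _ n]) (auto simp: truncate_def)
      then show ?thesis by (simp add: l2_norm_def truncate_def)
    qed
    moreover have "(\<lambda>n. sqrt (\<Sum>j. (cmod (a (j + n)))\<^sup>2)) \<longlonglongrightarrow> sqrt 0"
      by (intro tendsto_real_sqrt suminf_exist_split2 sm)
    ultimately show ?thesis by simp
  qed
  define w where "w = x - kalton_peck_map y"
  define t where "t n = l2_norm (y - truncate n y)" for n
  have tail: "y - truncate n y \<in> l2" for n using l2_diff(1)[OF y c00_l2[OF truncate_c00]] .
  have t: "t \<longlonglongrightarrow> 0" "\<And>n. 0 \<le> t n" using trunc[OF y] l2_norm_nonneg[OF tail] by (simp_all add: t_def[abs_def])
  have bound: "Z2_norm (z - (truncate n x, truncate n y))
      \<le> l2_norm (w - truncate n w) + (\<bar>t n * ln (t n)\<bar> + \<bar>ln (l2_norm y)\<bar> * t n) + t n" for n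
  proof -
    let ?r = "seq_scale (complex_of_real (ln (t n) - ln (l2_norm y))) (y - truncate n y)"
    have "x - truncate n x - kalton_peck_map (y - truncate n y) = (w - truncate n w) + ?r"
    proof
      fix j
      show "(x - truncate n x - kalton_peck_map (y - truncate n y)) j = ((w - truncate n w) + ?r) j"
        using kalton_peck_split[OF tail, of n j] kalton_peck_split[OF y, of j]
        by (auto simp: truncate_def w_def t_def algebra_simps zlog_def)
    qed
    moreover have "w - truncate n w \<in> l2" using l2_diff(1)[OF x c00_l2[OF truncate_c00]] by (simp add: w_def)
    ultimately have "l2_norm (x - truncate n x - kalton_peck_map (y - truncate n y))
      \<le> l2_norm (w - truncate n w) + l2_norm ?r"
      using l2_add(2) l2_scale[OF tail] by metis
    also have "l2_norm ?r = \<bar>ln (t n) - ln (l2_norm y)\<bar> * t n"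
      unfolding l2_norm_scale[OF tail] norm_of_real by (simp add: t_def)
    also have "\<dots> \<le> \<bar>t n * ln (t n)\<bar> + \<bar>ln (l2_norm y)\<bar> * t n"
    proof -
      have "\<bar>ln (t n) - ln (l2_norm y)\<bar> * t n \<le> (\<bar>ln (t n)\<bar> + \<bar>ln (l2_norm y)\<bar>) * t n"
        using t(2)[of n] by (intro mult_right_mono) auto
      then show ?thesis using t(2)[of n] by (simp add: abs_mult algebra_simps)
    qed
    finally show ?thesis unfolding z diff_Pair Z2_norm_eq t_def[symmetric] by linarith
  qed
  have "(\<lambda>n. l2_norm (w - truncate n w) + (\<bar>t n * ln (t n)\<bar> + \<bar>ln (l2_norm y)\<bar> * t n) + t n)
    \<longlonglongrightarrow> 0 + (\<bar>0\<bar> + \<bar>ln (l2_norm y)\<bar> * 0) + 0"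
    using x by (intro tendsto_intros tendsto_mult_ln_0 t trunc) (auto simp: w_def)
  then have "\<forall>\<^sub>F n in sequentially. l2_norm (w - truncate n w) + (\<bar>t n * ln (t n)\<bar> + \<bar>ln (l2_norm y)\<bar> * t n) + t n < \<epsilon>"
    using assms(2) by (intro order_tendstoD) auto
  then obtain n where "l2_norm (w - truncate n w) + (\<bar>t n * ln (t n)\<bar> + \<bar>ln (l2_norm y)\<bar> * t n) + t n < \<epsilon>"
    by (auto dest: eventually_happens)
  then show ?thesis using bound[of n] truncate_c00
    by (intro bexI[of _ "(truncate n x, truncate n y)"]) auto
qed

lemma c00_Z2: "x \<in> c00 \<Longrightarrow> y \<in> c00 \<Longrightarrow> (x, y) \<in> Z2"
proof -
  assume xy: "x \<in> c00" "y \<in> c00"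
  have "kalton_peck_map y \<in> c00"
    using xy(2) unfolding in_c00_iff by (auto simp: kalton_peck_map_def)
  then show ?thesis using xy by (simp add: Z2_iff c00_l2 l2_diff(1))
qed


section \<open>Completions with equivalent quasi-norms\<close>

context quasi_normed_space
begin

lemma zero_V: "0 \<in> V" and add_V: "x \<in> V \<Longrightarrow> y \<in> V \<Longrightarrow> x + y \<in> V"
  and scale_V: "x \<in> V \<Longrightarrow> sc c x \<in> V" and diff_V: "x \<in> V \<Longrightarrow> y \<in> V \<Longrightarrow> x - y \<in> V"
  using subspace_V by (auto intro: subspace_0 subspace_add subspace_scale subspace_diff)

lemma q_minus: "x \<in> V \<Longrightarrow> q (- x) = q x"
  using q_scale[of x "-1"] by (simp add: scale_minus_left)

lemma q_diff_commute: "x \<in> V \<Longrightarrow> y \<in> V \<Longrightarrow> q (x - y) = q (y - x)"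
  using q_minus[of "x - y"] diff_V by simp

lemma quasi_triangle:
  obtains K where "K \<ge> 1" "\<And>x y. x \<in> V \<Longrightarrow> y \<in> V \<Longrightarrow> q (x + y) \<le> K * (q x + q y)"
proof -
  obtain K where K: "\<forall>x\<in>V. \<forall>y\<in>V. q (x + y) \<le> K * (q x + q y)" using q_triangle by blast
  show thesis
  proof (rule that[of "max K 1"])
    fix x y assume "x \<in> V" "y \<in> V"
    then have "q (x + y) \<le> K * (q x + q y)" "0 \<le> q x + q y" using K q_nonneg by auto
    then show "q (x + y) \<le> max K 1 * (q x + q y)"
      by (meson max.cobounded1 mult_right_mono order_trans)
  qed simp
qed

end

text \<open>The graph of the extension to the completions of the identity of the common dense subspace.\<close>

definition completion_rel ::
  "'d set \<Rightarrow> ('d \<Rightarrow> 'b::ab_group_add) \<Rightarrow> ('b \<Rightarrow> real) \<Rightarrow> ('d \<Rightarrow> 'c::ab_group_add) \<Rightarrow> ('c \<Rightarrow> real) \<Rightarrow> 'b \<Rightarrow> 'c \<Rightarrow> bool"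
  where "completion_rel V1 \<iota> q2 \<kappa> q3 y z \<longleftrightarrow> (\<forall>\<epsilon>>0. \<exists>x\<in>V1. q2 (y - \<iota> x) < \<epsilon> \<and> q3 (z - \<kappa> x) < \<epsilon>)"

lemma completion_rel_swap: "completion_rel V1 \<iota> q2 \<kappa> q3 y z \<longleftrightarrow> completion_rel V1 \<kappa> q3 \<iota> q2 z y"
  by (auto simp: completion_rel_def)

text \<open>A common approximant x leads from q2 y to q1 x, then to r1 x, then to r3 z. Each
  approximation costs a triangle constant, so the bound is L * A * K instead of A.\<close>

lemma completion_rel_bound:
  assumes "is_completion s1 V1 q1 s2 V2 q2 \<iota>" "is_completion s1 V1 r1 s3 V3 r3 \<kappa>"
    and "0 < A" "\<And>x. x \<in> V1 \<Longrightarrow> r1 x \<le> A * q1 x"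
  shows "\<exists>B>0. \<forall>y\<in>V2. \<forall>z\<in>V3. completion_rel V1 \<iota> q2 \<kappa> r3 y z \<longrightarrow> r3 z \<le> B * q2 y"
proof -
  interpret Q: quasi_normed_space s2 V2 q2 using assms(1) by (simp add: is_completion_def)
  interpret R: quasi_normed_space s3 V3 r3 using assms(2) by (simp add: is_completion_def)
  have i: "\<iota> x \<in> V2" "q2 (\<iota> x) = q1 x" if "x \<in> V1" for x
    using assms(1) that by (auto simp: is_completion_def linear_between_def)
  have k: "\<kappa> x \<in> V3" "r3 (\<kappa> x) = r1 x" if "x \<in> V1" for x
    using assms(2) that by (auto simp: is_completion_def linear_between_def)
  obtain K where K: "K \<ge> 1" "\<And>x y. x \<in> V2 \<Longrightarrow> y \<in> V2 \<Longrightarrow> q2 (x + y) \<le> K * (q2 x + q2 y)"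
    using Q.quasi_triangle by blast
  obtain L where L: "L \<ge> 1" "\<And>x y. x \<in> V3 \<Longrightarrow> y \<in> V3 \<Longrightarrow> r3 (x + y) \<le> L * (r3 x + r3 y)"
    using R.quasi_triangle by blast
  show ?thesis
  proof (intro exI[of _ "L * A * K"] conjI ballI impI)
    show "0 < L * A * K" using K L assms(3) by simp
  next
    fix y z assume y: "y \<in> V2" and z: "z \<in> V3" and rel: "completion_rel V1 \<iota> q2 \<kappa> r3 y z"
    show "r3 z \<le> L * A * K * q2 y"
    proof (rule field_le_epsilon)
      fix e :: real assume e: "0 < e"
      \<comment> \<open>Chosen so that the accumulated error L (1 + A K) d equals e.\<close>
      define d where "d = e / (L * (1 + A * K))"
      have pos: "0 < L * (1 + A * K)" using K L assms(3) by (intro mult_pos_pos add_pos_pos) auto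
      then have "0 < d" using e by (simp add: d_def)
      with rel obtain x where x: "x \<in> V1" "q2 (y - \<iota> x) < d" "r3 (z - \<kappa> x) < d"
        by (auto simp: completion_rel_def)
      have "q1 x = q2 ((\<iota> x - y) + y)" using i x by simp
      also have "\<dots> \<le> K * (q2 (\<iota> x - y) + q2 y)" using x y i by (intro K(2) Q.diff_V) auto
      also have "\<dots> \<le> K * (d + q2 y)"
        using x y i K(1) by (intro mult_left_mono add_right_mono) (auto simp: Q.q_diff_commute[of "\<iota> x"])
      finally have q1: "q1 x \<le> K * (d + q2 y)" .
      have "r3 z = r3 ((z - \<kappa> x) + \<kappa> x)" by simp
      also have "\<dots> \<le> L * (r3 (z - \<kappa> x) + r3 (\<kappa> x))" using x z k by (intro L(2) R.diff_V) auto
      also have "\<dots> \<le> L * (d + A * (K * (d + q2 y)))"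
      proof (intro mult_left_mono add_mono)
        have "r3 (\<kappa> x) \<le> A * q1 x" using k(2)[OF x(1)] assms(4)[OF x(1)] by simp
        also have "\<dots> \<le> A * (K * (d + q2 y))" using q1 assms(3) by (intro mult_left_mono) auto
        finally show "r3 (\<kappa> x) \<le> A * (K * (d + q2 y))" .
      qed (use x L in auto)
      also have "\<dots> = L * A * K * q2 y + L * (1 + A * K) * d" by (simp add: algebra_simps)
      also have "L * (1 + A * K) * d = e" using pos unfolding d_def by (metis less_numeral_extra(3) nonzero_mult_div_cancel_left times_divide_eq_right)
      finally show "r3 z \<le> L * A * K * q2 y + e" .
    qed
  qed
qed

text \<open>Approximants of \<open>y\<close> form a Cauchy sequence for the first quasi-norm, hence
  by domination for the second; completeness of \<open>V3\<close> supplies \<open>z\<close>.\<close>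

lemma completion_rel_total:
  assumes "is_completion s1 V1 q1 s2 V2 q2 \<iota>" "is_completion s1 V1 r1 s3 V3 r3 \<kappa>"
    and "vector_space s1" "module.subspace s1 V1"
    and "0 < A" "\<And>x. x \<in> V1 \<Longrightarrow> r1 x \<le> A * q1 x"
    and y: "y \<in> V2"
  shows "\<exists>z\<in>V3. completion_rel V1 \<iota> q2 \<kappa> r3 y z"
proof -
  interpret S: vector_space s1 by fact
  interpret Q: quasi_normed_space s2 V2 q2 using assms(1) by (simp add: is_completion_def)
  interpret R: quasi_normed_space s3 V3 r3 using assms(2) by (simp add: is_completion_def)
  have i: "\<iota> x \<in> V2" "q2 (\<iota> x) = q1 x" if "x \<in> V1" for x
    using assms(1) that by (auto simp: is_completion_def linear_between_def)
  have k: "\<kappa> x \<in> V3" "r3 (\<kappa> x) = r1 x" if "x \<in> V1" for x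
    using assms(2) that by (auto simp: is_completion_def linear_between_def)
  have V1: "x - y \<in> V1" "s1 (-1) y \<in> V1" if "x \<in> V1" "y \<in> V1" for x y
    using S.subspace_diff[OF assms(4)] S.subspace_scale[OF assms(4)] that by blast+
  have lin: "\<iota> (x - y) = \<iota> x - \<iota> y" "\<kappa> (x - y) = \<kappa> x - \<kappa> y" if "x \<in> V1" "y \<in> V1" for x y
  proof -
    have eq: "x - y = x + s1 (-1) y" by (simp add: S.scale_minus_left)
    show "\<iota> (x - y) = \<iota> x - \<iota> y" "\<kappa> (x - y) = \<kappa> x - \<kappa> y"
      unfolding eq using assms(1,2) that V1(2)[OF that]
      by (simp_all add: is_completion_def linear_between_def del: S.scale_minus_left)
  qed
  obtain K where K: "K \<ge> 1" "\<And>x y. x \<in> V2 \<Longrightarrow> y \<in> V2 \<Longrightarrow> q2 (x + y) \<le> K * (q2 x + q2 y)"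
    using Q.quasi_triangle by blast
  have "\<exists>x\<in>V1. q2 (y - \<iota> x) < 1 / real (Suc n)" for n
    using assms(1) y by (auto simp: is_completion_def)
  then obtain x where x: "\<And>n. x n \<in> V1" "\<And>n. q2 (y - \<iota> (x n)) < 1 / real (Suc n)" by metis
  have xlim: "\<exists>M. \<forall>n\<ge>M. q2 (y - \<iota> (x n)) < \<epsilon>" if "\<epsilon> > 0" for \<epsilon>
  proof -
    obtain M where M: "1 / real (Suc M) < \<epsilon>" using nat_approx_posE[OF \<open>\<epsilon> > 0\<close>] by blast
    have "q2 (y - \<iota> (x n)) < \<epsilon>" if "n \<ge> M" for n
    proof -
      have "1 / real (Suc n) \<le> 1 / real (Suc M)" using that by (intro divide_left_mono) auto
      then show ?thesis using x(2)[of n] M by linarith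
    qed
    then show ?thesis by blast
  qed
  have "\<exists>M. \<forall>m\<ge>M. \<forall>n\<ge>M. r3 (\<kappa> (x m) - \<kappa> (x n)) < \<epsilon>" if "\<epsilon> > 0" for \<epsilon>
  proof -
    define d where "d = \<epsilon> / (2 * A * K)"
    have "0 < d" using that assms(5) K(1) by (simp add: d_def)
    then obtain M where M: "\<forall>n\<ge>M. q2 (y - \<iota> (x n)) < d" using xlim by blast
    have "r3 (\<kappa> (x m) - \<kappa> (x n)) < \<epsilon>" if "m \<ge> M" "n \<ge> M" for m n
    proof -
      have "r3 (\<kappa> (x m) - \<kappa> (x n)) = r1 (x m - x n)"
        using k(2)[OF V1(1)] lin x by metis
      also have "\<dots> \<le> A * q1 (x m - x n)" using assms(6) V1 x by auto
      also have "q1 (x m - x n) = q2 ((\<iota> (x m) - y) + (y - \<iota> (x n)))"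
        using i(2)[OF V1(1)] lin x by (metis diff_add_cancel add_diff_eq)
      also have "\<dots> \<le> K * (q2 (\<iota> (x m) - y) + q2 (y - \<iota> (x n)))"
        using x y i by (intro K(2) Q.diff_V) auto
      also have "\<dots> < K * (d + d)"
        using M that x y i K(1) by (intro mult_strict_left_mono add_strict_mono) (auto simp: Q.q_diff_commute[of "\<iota> (x m)"])
      finally show ?thesis using assms(5) K(1) by (simp add: d_def field_simps)
    qed
    then show ?thesis by blast
  qed
  then obtain z where z: "z \<in> V3" "(\<lambda>n. r3 (\<kappa> (x n) - z)) \<longlonglongrightarrow> 0"
    using assms(2) k(1)[OF x(1)] unfolding is_completion_def q_complete_def
    by (elim conjE allE[of _ "\<lambda>n. \<kappa> (x n)"]) auto
  have "completion_rel V1 \<iota> q2 \<kappa> r3 y z" unfolding completion_rel_def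
  proof (intro allI impI)
    fix \<epsilon> :: real assume "\<epsilon> > 0"
    then obtain M where M: "\<forall>n\<ge>M. q2 (y - \<iota> (x n)) < \<epsilon>" using xlim by blast
    have "\<forall>\<^sub>F n in sequentially. r3 (\<kappa> (x n) - z) < \<epsilon>"
      using order_tendstoD(2)[OF z(2) \<open>\<epsilon> > 0\<close>] .
    then obtain M' where M': "\<forall>n\<ge>M'. r3 (\<kappa> (x n) - z) < \<epsilon>" by (auto simp: eventually_sequentially)
    show "\<exists>x\<in>V1. q2 (y - \<iota> x) < \<epsilon> \<and> r3 (z - \<kappa> x) < \<epsilon>"
      using M M' x(1) z(1) k(1) R.q_diff_commute[of z]
      by (intro bexI[of _ "x (max M M')"]) auto
  qed
  then show ?thesis using z(1) by blast
qed

lemma completion_rel_add: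
  assumes "is_completion s1 V1 q1 s2 V2 q2 \<iota>" "is_completion s1 V1 r1 s3 V3 r3 \<kappa>"
    and "vector_space s1" "module.subspace s1 V1"
    and "y \<in> V2" "z \<in> V3" "completion_rel V1 \<iota> q2 \<kappa> r3 y z"
    and "y' \<in> V2" "z' \<in> V3" "completion_rel V1 \<iota> q2 \<kappa> r3 y' z'"
  shows "completion_rel V1 \<iota> q2 \<kappa> r3 (y + y') (z + z')"
  unfolding completion_rel_def
proof (intro allI impI)
  fix \<epsilon> :: real assume e: "\<epsilon> > 0"
  interpret S: vector_space s1 by fact
  interpret Q: quasi_normed_space s2 V2 q2 using assms(1) by (simp add: is_completion_def)
  interpret R: quasi_normed_space s3 V3 r3 using assms(2) by (simp add: is_completion_def)
  have i: "\<iota> x \<in> V2" "\<kappa> x \<in> V3" if "x \<in> V1" for x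
    using assms(1,2) that by (auto simp: is_completion_def linear_between_def)
  obtain K where K: "K \<ge> 1" "\<And>x y. x \<in> V2 \<Longrightarrow> y \<in> V2 \<Longrightarrow> q2 (x + y) \<le> K * (q2 x + q2 y)"
    using Q.quasi_triangle by blast
  obtain L where L: "L \<ge> 1" "\<And>x y. x \<in> V3 \<Longrightarrow> y \<in> V3 \<Longrightarrow> r3 (x + y) \<le> L * (r3 x + r3 y)"
    using R.quasi_triangle by blast
  define d where "d = \<epsilon> / (2 * max K L)"
  have ml: "0 < max K L" using K(1) by auto
  have "0 < d" using e K(1) by (simp add: d_def)
  with assms(7) obtain x where x: "x \<in> V1" "q2 (y - \<iota> x) < d" "r3 (z - \<kappa> x) < d"
    unfolding completion_rel_def by blast
  from assms(10) \<open>0 < d\<close> obtain x' where x': "x' \<in> V1" "q2 (y' - \<iota> x') < d" "r3 (z' - \<kappa> x') < d"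
    unfolding completion_rel_def by blast
  have xx: "x + x' \<in> V1" using S.subspace_add[OF assms(4)] x x' by auto
  have lin: "\<iota> (x + x') = \<iota> x + \<iota> x'" "\<kappa> (x + x') = \<kappa> x + \<kappa> x'"
    using assms(1,2) x(1) x'(1) by (auto simp: is_completion_def linear_between_def)
  have "q2 (y + y' - \<iota> (x + x')) = q2 ((y - \<iota> x) + (y' - \<iota> x'))" unfolding lin by (simp add: algebra_simps)
  also have "\<dots> \<le> K * (q2 (y - \<iota> x) + q2 (y' - \<iota> x'))"
    using i x x' assms by (intro K(2) Q.diff_V) auto
  also have "\<dots> < K * (d + d)" using x x' K(1) by (intro mult_strict_left_mono add_strict_mono) auto
  also have "\<dots> \<le> max K L * (d + d)" using \<open>0 < d\<close> by (intro mult_right_mono) auto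
  also have "\<dots> = \<epsilon>" using ml by (simp add: d_def field_simps)
  finally have 1: "q2 (y + y' - \<iota> (x + x')) < \<epsilon>" .
  have "r3 (z + z' - \<kappa> (x + x')) = r3 ((z - \<kappa> x) + (z' - \<kappa> x'))" unfolding lin by (simp add: algebra_simps)
  also have "\<dots> \<le> L * (r3 (z - \<kappa> x) + r3 (z' - \<kappa> x'))"
    using i x x' assms by (intro L(2) R.diff_V) auto
  also have "\<dots> < L * (d + d)" using x x' L(1) by (intro mult_strict_left_mono add_strict_mono) auto
  also have "\<dots> \<le> max K L * (d + d)" using \<open>0 < d\<close> by (intro mult_right_mono) auto
  also have "\<dots> = \<epsilon>" using ml by (simp add: d_def field_simps)
  finally have 2: "r3 (z + z' - \<kappa> (x + x')) < \<epsilon>" .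
  from 1 2 xx show "\<exists>x\<in>V1. q2 (y + y' - \<iota> x) < \<epsilon> \<and> r3 (z + z' - \<kappa> x) < \<epsilon>" by blast
qed

lemma completion_rel_scale:
  assumes "is_completion s1 V1 q1 s2 V2 q2 \<iota>" "is_completion s1 V1 r1 s3 V3 r3 \<kappa>"
    and "vector_space s1" "module.subspace s1 V1"
    and "y \<in> V2" "z \<in> V3" "completion_rel V1 \<iota> q2 \<kappa> r3 y z"
  shows "completion_rel V1 \<iota> q2 \<kappa> r3 (s2 c y) (s3 c z)"
  unfolding completion_rel_def
proof (intro allI impI)
  fix \<epsilon> :: real assume e: "\<epsilon> > 0"
  interpret S: vector_space s1 by fact
  interpret Q: quasi_normed_space s2 V2 q2 using assms(1) by (simp add: is_completion_def)
  interpret R: quasi_normed_space s3 V3 r3 using assms(2) by (simp add: is_completion_def)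
  have i: "\<iota> x \<in> V2" "\<kappa> x \<in> V3" if "x \<in> V1" for x
    using assms(1,2) that by (auto simp: is_completion_def linear_between_def)
  define d where "d = \<epsilon> / (1 + cmod c)"
  have pos: "0 < 1 + cmod c" by (simp add: add_pos_nonneg)
  then have "0 < d" using e by (simp add: d_def)
  with assms(7) obtain x where x: "x \<in> V1" "q2 (y - \<iota> x) < d" "r3 (z - \<kappa> x) < d"
    unfolding completion_rel_def by blast
  have lin: "\<iota> (s1 c x) = s2 c (\<iota> x)" "\<kappa> (s1 c x) = s3 c (\<kappa> x)"
    using assms(1,2) x(1) by (auto simp: is_completion_def linear_between_def)
  have cd: "cmod c * a < \<epsilon>" if "a < d" "0 \<le> a" for a
  proof -
    have "cmod c * a \<le> (1 + cmod c) * a" using that by (intro mult_right_mono) auto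
    also have "\<dots> < (1 + cmod c) * d" using that pos by (intro mult_strict_left_mono) auto
    also have "\<dots> = \<epsilon>" using pos by (simp add: d_def)
    finally show ?thesis .
  qed
  have mem: "y - \<iota> x \<in> V2" "z - \<kappa> x \<in> V3" using x i assms by (auto intro: Q.diff_V R.diff_V)
  have "q2 (s2 c y - \<iota> (s1 c x)) = cmod c * q2 (y - \<iota> x)"
    using Q.q_scale[OF mem(1), of c] by (simp add: lin Q.scale_right_diff_distrib)
  moreover have "r3 (s3 c z - \<kappa> (s1 c x)) = cmod c * r3 (z - \<kappa> x)"
    using R.q_scale[OF mem(2), of c] by (simp add: lin R.scale_right_diff_distrib)
  moreover have "s1 c x \<in> V1" using S.subspace_scale[OF assms(4)] x by auto
  ultimately show "\<exists>x\<in>V1. q2 (s2 c y - \<iota> x) < \<epsilon> \<and> r3 (s3 c z - \<kappa> x) < \<epsilon>"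
    using cd x mem Q.q_nonneg R.q_nonneg by (intro bexI[of _ "s1 c x"]) auto
qed

text \<open>The relation respects linear combinations, so 0 is related to z - z', and the bound
  forces this difference to have quasi-norm 0.\<close>

lemma completion_rel_unique:
  assumes "is_completion s1 V1 q1 s2 V2 q2 \<iota>" "is_completion s1 V1 r1 s3 V3 r3 \<kappa>"
    and "vector_space s1" "module.subspace s1 V1"
    and "0 < A" "\<And>x. x \<in> V1 \<Longrightarrow> r1 x \<le> A * q1 x"
    and "y \<in> V2" "z \<in> V3" "completion_rel V1 \<iota> q2 \<kappa> r3 y z"
    and "z' \<in> V3" "completion_rel V1 \<iota> q2 \<kappa> r3 y z'"
  shows "z = z'"
proof -
  interpret Q: quasi_normed_space s2 V2 q2 using assms(1) by (simp add: is_completion_def)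
  interpret R: quasi_normed_space s3 V3 r3 using assms(2) by (simp add: is_completion_def)
  obtain B where "0 < B" and B: "\<And>y z. y \<in> V2 \<Longrightarrow> z \<in> V3 \<Longrightarrow> completion_rel V1 \<iota> q2 \<kappa> r3 y z \<Longrightarrow> r3 z \<le> B * q2 y"
    using completion_rel_bound[OF assms(1,2,5,6)] by auto
  have "completion_rel V1 \<iota> q2 \<kappa> r3 (y + s2 (-1) y) (z + s3 (-1) z')"
    by (rule completion_rel_add[OF assms(1-4,7-9) Q.scale_V[OF assms(7)] R.scale_V[OF assms(10)]
          completion_rel_scale[OF assms(1-4,7,10,11)]])
  then have "completion_rel V1 \<iota> q2 \<kappa> r3 0 (z - z')"
    by (simp add: Q.scale_minus_left R.scale_minus_left)
  then have "r3 (z - z') \<le> B * q2 0" using B Q.zero_V R.diff_V assms by blast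
  then have "r3 (z - z') = 0" using Q.q_eq_0[OF Q.zero_V] R.q_nonneg[OF R.diff_V[OF assms(8,10)]] by simp
  then show ?thesis using R.q_eq_0 R.diff_V[OF assms(8,10)] by simp
qed

text \<open>By totality and uniqueness the relation is the graph of a map. The hypotheses are
  symmetric in the two completions, and exchanging the roles yields injectivity, surjectivity and
  the lower bound.\<close>

lemma isomorphic_completions:
  assumes 1: "is_completion s1 V1 q1 s2 V2 q2 \<iota>" and 2: "is_completion s1 V1 r1 s3 V3 r3 \<kappa>"
    and vs: "vector_space s1" and ss: "module.subspace s1 V1"
    and A: "0 < A" "\<And>x. x \<in> V1 \<Longrightarrow> r1 x \<le> A * q1 x"
    and A': "0 < A'" "\<And>x. x \<in> V1 \<Longrightarrow> q1 x \<le> A' * r1 x"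
  shows "isomorphic_spaces s2 V2 q2 s3 V3 r3"
proof -
  interpret Q: quasi_normed_space s2 V2 q2 using 1 by (simp add: is_completion_def)
  interpret R: quasi_normed_space s3 V3 r3 using 2 by (simp add: is_completion_def)
  let ?rel = "completion_rel V1 \<iota> q2 \<kappa> r3"
  define T where "T y = (SOME z. z \<in> V3 \<and> ?rel y z)" for y
  have T: "T y \<in> V3" "?rel y (T y)" if "y \<in> V2" for y
    using someI_ex[of "\<lambda>z. z \<in> V3 \<and> ?rel y z"] completion_rel_total[OF 1 2 vs ss A that]
    unfolding T_def by blast+
  have Teq: "T y = z" if "y \<in> V2" "z \<in> V3" "?rel y z" for y z
    using completion_rel_unique[OF 1 2 vs ss A that(1) T[OF that(1)] that(2,3)] .
  obtain B where B: "0 < B" "\<And>y z. y \<in> V2 \<Longrightarrow> z \<in> V3 \<Longrightarrow> ?rel y z \<Longrightarrow> r3 z \<le> B * q2 y"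
    using completion_rel_bound[OF 1 2 A] by auto
  obtain B' where B': "0 < B'" "\<And>y z. y \<in> V2 \<Longrightarrow> z \<in> V3 \<Longrightarrow> ?rel y z \<Longrightarrow> q2 y \<le> B' * r3 z"
    using completion_rel_bound[OF 2 1 A'] by (auto simp: completion_rel_swap[of V1 \<iota>])
  show ?thesis unfolding isomorphic_spaces_def
  proof (intro exI[of _ T] conjI)
    show "linear_between s2 V2 s3 V3 T" unfolding linear_between_def
    proof (intro conjI ballI allI)
      show "T ` V2 \<subseteq> V3" using T by auto
      show "T (x + y) = T x + T y" if "x \<in> V2" "y \<in> V2" for x y
        using that T by (intro Teq Q.add_V R.add_V completion_rel_add[OF 1 2 vs ss]) auto
      show "T (s2 c x) = s3 c (T x)" if "x \<in> V2" for c x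
        using that T by (intro Teq Q.scale_V R.scale_V completion_rel_scale[OF 1 2 vs ss]) auto
    qed
    show "bij_betw T V2 V3" unfolding bij_betw_def
    proof
      show "inj_on T V2"
      proof (rule inj_onI)
        fix x y assume xy: "x \<in> V2" "y \<in> V2" "T x = T y"
        then have "?rel x (T x)" "?rel y (T x)" "T x \<in> V3" using T by metis+
        then show "x = y"
          using completion_rel_unique[OF 2 1 vs ss A', of "T x" x y] xy completion_rel_swap by metis
      qed
      show "T ` V2 = V3"
      proof
        show "V3 \<subseteq> T ` V2"
        proof
          fix z assume z: "z \<in> V3"
          then obtain y where "y \<in> V2" "?rel y z"
            using completion_rel_total[OF 2 1 vs ss A'] completion_rel_swap by metis
          then show "z \<in> T ` V2" using Teq z by blast
        qed
      qed (use T in auto)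
    qed
    show "\<exists>A>0. \<exists>B>0. \<forall>x\<in>V2. A * q2 x \<le> r3 (T x) \<and> r3 (T x) \<le> B * q2 x"
    proof (rule exI[of _ "1 / B'"], intro conjI exI[of _ B] ballI)
      fix x assume x: "x \<in> V2"
      show "1 / B' * q2 x \<le> r3 (T x)" using B'(2)[OF x T[OF x]] B'(1) by (simp add: field_simps)
      show "r3 (T x) \<le> B * q2 x" using B(2)[OF x T[OF x]] .
    qed (use B B' in auto)
  qed
qed


section \<open>Stability of factorizations\<close>

text \<open>Comes from t^2 <= 2 e^t with t = |ln r|, since e^t is then one of r and 1/r.\<close>

lemma ln_square_le: "0 < r \<Longrightarrow> (ln r)\<^sup>2 \<le> 2 * (r + 1 / r)" for r :: real
proof -
  assume r: "0 < r"
  have *: "t\<^sup>2 \<le> 2 * exp t" if "0 \<le> t" for t :: real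
    using exp_lower_Taylor_quadratic[OF that] that by (simp add: field_simps)
  show ?thesis
  proof (cases "0 \<le> ln r")
    case True
    then show ?thesis using *[of "ln r"] r by (simp add: add_increasing2)
  next
    case False
    then have "(ln r)\<^sup>2 \<le> 2 * (1 / r)" using *[of "- ln r"] r by (simp add: exp_minus field_simps)
    also have "\<dots> \<le> 2 * (r + 1 / r)" using r by simp
    finally show ?thesis .
  qed
qed

text \<open>With \<open>r = v' / v\<close>, the two hypotheses bound the averages of \<open>r\<close> and of \<open>1 / r\<close> with respect
  to the weight \<open>v w\<close>, and \<open>(ln r)\<^sup>2\<close> is dominated by \<open>r + 1 / r\<close>.\<close>

lemma factorization_stability:
  fixes v w v' w' :: "'i \<Rightarrow> real"
  assumes "\<And>i. i \<in> S \<Longrightarrow> 0 < v i \<and> 0 < w i \<and> 0 < v' i \<and> 0 < w' i \<and> v i * w i = v' i * w' i"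
    and "(\<Sum>i\<in>S. w i * v' i) \<le> C" "(\<Sum>i\<in>S. w' i * v i) \<le> C"
  shows "(\<Sum>i\<in>S. v i * w i * ((ln (w' i) - ln (v' i)) - (ln (w i) - ln (v i)))\<^sup>2) \<le> 16 * C"
proof -
  have "v i * w i * ((ln (w' i) - ln (v' i)) - (ln (w i) - ln (v i)))\<^sup>2
      \<le> 8 * (w i * v' i + w' i * v i)" if "i \<in> S" for i
  proof -
    have pos: "0 < v i" "0 < w i" "0 < v' i" "0 < w' i" and eq: "v i * w i = v' i * w' i"
      using assms(1)[OF that] by auto
    have "ln (v i) + ln (w i) = ln (v' i) + ln (w' i)"
      using arg_cong[OF eq, of ln] pos by (simp add: ln_mult)
    \<comment> \<open>As v w = v' w', the logarithms of w'/w and v'/v are opposite, so the two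
      differences add up to a factor 2.\<close>
    then have l: "(ln (w' i) - ln (v' i)) - (ln (w i) - ln (v i)) = - 2 * ln (v' i / v i)"
      using pos by (simp add: ln_div)
    have "v i * w i * (- 2 * ln (v' i / v i))\<^sup>2 = 4 * (v i * w i) * (ln (v' i / v i))\<^sup>2"
      by (simp add: power_mult_distrib)
    also have "\<dots> \<le> 4 * (v i * w i) * (2 * (v' i / v i + 1 / (v' i / v i)))"
      using pos by (intro mult_left_mono ln_square_le) auto
    also have "\<dots> = 8 * (w i * v' i) + 8 * (v i * w i * v i / v' i)"
      using pos by (simp add: field_simps)
    also have "v i * w i * v i / v' i = w' i * v i" using pos by (simp add: eq)
    finally show ?thesis unfolding l by simp
  qed
  then have "(\<Sum>i\<in>S. v i * w i * ((ln (w' i) - ln (v' i)) - (ln (w i) - ln (v i)))\<^sup>2)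
      \<le> (\<Sum>i\<in>S. 8 * (w i * v' i + w' i * v i))" by (rule sum_mono)
  also have "\<dots> = 8 * ((\<Sum>i\<in>S. w i * v' i) + (\<Sum>i\<in>S. w' i * v i))"
    by (simp add: sum_distrib_left[symmetric] sum.distrib)
  also have "\<dots> \<le> 16 * C" using assms(2,3) by simp
  finally show ?thesis .
qed

text \<open>Young's inequality term by term after dividing \<open>s\<close> by its p-norm. Writing 1
  - 1/p instead of a conjugate exponent includes the case p = 1.\<close>

lemma Hoelder_sum_powr:
  fixes x s :: "'i \<Rightarrow> real"
  assumes "finite J" "1 \<le> p" "\<And>j. j \<in> J \<Longrightarrow> 0 \<le> x j" "(\<Sum>j\<in>J. x j) = 1" "\<And>j. j \<in> J \<Longrightarrow> 0 \<le> s j"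
  shows "(\<Sum>j\<in>J. x j powr (1 - 1 / p) * s j) \<le> (\<Sum>j\<in>J. s j powr p) powr (1 / p)"
proof -
  define \<sigma> where "\<sigma> = (\<Sum>j\<in>J. s j powr p) powr (1 / p)"
  have S0: "0 \<le> (\<Sum>j\<in>J. s j powr p)" by (intro sum_nonneg) auto
  show ?thesis
  proof (cases "\<sigma> = 0")
    case True
    then have "(\<Sum>j\<in>J. s j powr p) = 0" by (simp add: \<sigma>_def)
    then have "\<forall>j\<in>J. s j powr p = 0" using assms(1) by (subst (asm) sum_nonneg_eq_0_iff) auto
    then have "\<forall>j\<in>J. s j = 0" by auto
    then show ?thesis using True by (simp add: \<sigma>_def)
  next
    case False
    then have \<sigma>: "0 < \<sigma>" by (simp add: \<sigma>_def)
    have \<sigma>p: "\<sigma> powr p = (\<Sum>j\<in>J. s j powr p)" using assms(2) S0 by (simp add: \<sigma>_def powr_powr)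
    have "x j powr (1 - 1 / p) * (s j / \<sigma>) \<le> (1 - 1 / p) * x j + (1 / p) * (s j powr p / \<sigma> powr p)"
      if j: "j \<in> J" for j
    proof (cases "x j = 0 \<or> s j = 0")
      case True
      have "0 \<le> (1 - 1 / p) * x j" "0 \<le> (1 / p) * (s j powr p / \<sigma> powr p)"
        using assms(2) assms(3)[OF j] by auto
      then show ?thesis using True by auto
    next
      case False
      then have pos: "0 < x j" "0 < s j" using assms(3,5)[OF j] by auto
      have "s j / \<sigma> = ((s j / \<sigma>) powr p) powr (1 / p)" using pos \<sigma> assms(2) by (simp add: powr_powr)
      moreover have "x j powr (1 - 1 / p) * ((s j / \<sigma>) powr p) powr (1 / p)
          \<le> (1 - 1 / p) * x j + (1 / p) * (s j / \<sigma>) powr p"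
        using pos \<sigma> assms(2) by (intro Youngs_inequality_0) auto
      ultimately have "x j powr (1 - 1 / p) * (s j / \<sigma>) \<le> (1 - 1 / p) * x j + (1 / p) * (s j / \<sigma>) powr p" by metis
      then show ?thesis using pos \<sigma> by (simp add: powr_divide)
    qed
    then have "(\<Sum>j\<in>J. x j powr (1 - 1 / p) * (s j / \<sigma>))
        \<le> (\<Sum>j\<in>J. (1 - 1 / p) * x j + (1 / p) * (s j powr p / \<sigma> powr p))" by (rule sum_mono)
    also have "\<dots> = (1 - 1 / p) * (\<Sum>j\<in>J. x j) + (1 / p) * ((\<Sum>j\<in>J. s j powr p) / \<sigma> powr p)"
      by (simp add: sum.distrib sum_distrib_left sum_divide_distrib)
    also have "\<dots> = 1" using \<sigma> \<sigma>p[symmetric] assms(2,4) by simp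
    finally have "(\<Sum>j\<in>J. x j powr (1 - 1 / p) * s j) / \<sigma> \<le> 1" by (simp add: sum_divide_distrib)
    then show ?thesis using \<sigma> by (simp add: \<sigma>_def[symmetric])
  qed
qed


section \<open>Finitely supported vectors and functionals\<close>

locale one_unconditional_space = complex_banach sc
  for sc :: "complex \<Rightarrow> 'a::banach \<Rightarrow> 'a" +
  fixes e :: "nat \<Rightarrow> 'a" and N :: "'a \<Rightarrow> real"
  assumes basis: "schauder_basis sc e"
    and equivalent: "equivalent_norm sc N"
    and unconditional: "one_unconditional sc e N"
begin

lemma synth_finite:
  assumes "finite F" "supp a \<subseteq> F"
  shows "(\<lambda>j. sc (a j) (e j)) sums (\<Sum>j\<in>F. sc (a j) (e j))" "synth sc e a = (\<Sum>j\<in>F. sc (a j) (e j))"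
proof -
  show "(\<lambda>j. sc (a j) (e j)) sums (\<Sum>j\<in>F. sc (a j) (e j))"
    using assms by (intro sums_finite) (auto simp: supp_def)
  then show "synth sc e a = (\<Sum>j\<in>F. sc (a j) (e j))" by (simp add: synth_def sums_iff)
qed

lemma coords_synth: "a \<in> c00 \<Longrightarrow> coords sc e (synth sc e a) = a"
proof -
  assume a: "a \<in> c00"
  then have "(\<lambda>j. sc (a j) (e j)) sums (synth sc e a)"
    using synth_finite[of "supp a" a] by (simp add: c00_def)
  then show ?thesis unfolding coords_def using basis unfolding schauder_basis_def
    by (metis (mono_tags, lifting) the_equality)
qed

lemma synth_zero: "synth sc e 0 = 0"
  using synth_finite(2)[of "{}" 0] by (simp add: supp_def)

lemma synth_eq_0: "a \<in> c00 \<Longrightarrow> synth sc e a = 0 \<Longrightarrow> a = 0"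
  using coords_synth[of a] coords_synth[OF c00_zero] synth_zero by metis

lemma synth_sum:
  assumes "finite J" "\<And>j. j \<in> J \<Longrightarrow> u j \<in> c00"
  shows "synth sc e (\<Sum>j\<in>J. seq_scale (c j) (u j)) = (\<Sum>j\<in>J. sc (c j) (synth sc e (u j)))"
proof -
  define F where "F = (\<Union>j\<in>J. supp (u j))"
  have F: "finite F" using assms by (auto simp: F_def c00_def)
  have "supp (\<Sum>j\<in>J. seq_scale (c j) (u j)) \<subseteq> F"
    unfolding F_def supp_def by (auto simp: sum_fun_apply) (metis (mono_tags, lifting) mult_zero_right sum.neutral)
  then have "synth sc e (\<Sum>j\<in>J. seq_scale (c j) (u j)) = (\<Sum>i\<in>F. sc ((\<Sum>j\<in>J. seq_scale (c j) (u j)) i) (e i))"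
    by (rule synth_finite(2)[OF F])
  also have "\<dots> = (\<Sum>i\<in>F. \<Sum>j\<in>J. sc (c j) (sc (u j i) (e i)))"
    by (simp add: sum_fun_apply scale_sum_left)
  also have "\<dots> = (\<Sum>j\<in>J. sc (c j) (\<Sum>i\<in>F. sc (u j i) (e i)))"
    by (subst sum.swap) (simp add: scale_sum_right)
  also have "\<dots> = (\<Sum>j\<in>J. sc (c j) (synth sc e (u j)))"
    using F by (intro sum.cong refl arg_cong[of _ _ "sc _"] synth_finite(2)[symmetric]) (auto simp: F_def)
  finally show ?thesis .
qed

lemma synth_scale: "u \<in> c00 \<Longrightarrow> synth sc e (seq_scale c u) = sc c (synth sc e u)"
  using synth_sum[of "{()}" "\<lambda>_. u" "\<lambda>_. c"] by simp

lemma N_synth_mono: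
  assumes "a \<in> c00" "b \<in> c00" "\<And>j. cmod (a j) \<le> cmod (b j)"
  shows "N (synth sc e a) \<le> N (synth sc e b)"
  using assms unconditional coords_synth unfolding one_unconditional_def by metis

lemma norm_bounds:
  obtains \<alpha> \<beta> where "0 < \<alpha>" "0 < \<beta>" "\<And>x. \<alpha> * norm x \<le> N x" "\<And>x. N x \<le> \<beta> * norm x"
  using equivalent unfolding equivalent_norm_def by blast

lemma N_nonneg: "0 \<le> N x"
proof -
  obtain \<alpha> \<beta> where "0 < \<alpha>" "\<alpha> * norm x \<le> N x" using norm_bounds by metis
  then show ?thesis using norm_ge_zero[of x] by (meson dual_order.trans less_imp_le mult_nonneg_nonneg)
qed

lemma dual_eqI:
  assumes "\<phi> \<in> dual sc" "\<psi> \<in> dual sc" "\<And>j. \<phi> (e j) = \<psi> (e j)"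
  shows "\<phi> = \<psi>"
proof
  fix x
  obtain a where a: "(\<lambda>j. sc (a j) (e j)) sums x" using basis unfolding schauder_basis_def by blast
  have b: "bounded_linear \<phi>" "bounded_linear \<psi>" and s: "\<And>c x. \<phi> (sc c x) = c * \<phi> x" "\<And>c x. \<psi> (sc c x) = c * \<psi> x"
    using assms by (auto simp: dual_def)
  have "(\<lambda>j. a j * \<phi> (e j)) sums \<phi> x" "(\<lambda>j. a j * \<psi> (e j)) sums \<psi> x"
    using bounded_linear.sums[OF b(1) a] bounded_linear.sums[OF b(2) a] by (simp_all add: s)
  then show "\<phi> x = \<psi> x" using assms(3) sums_unique2 by (metis (no_types, lifting) sums_cong)
qed

text \<open>A functional is determined by its values on the basis, so the definite description in
  \<open>dual_seq_norm\<close> denotes \<phi>; the supremum is finite because \<open>N\<close> is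
  equivalent to the norm.\<close>

lemma dual_seq_functional:
  assumes "w \<in> dual_seq_space sc e"
  obtains \<phi> where "\<phi> \<in> dual sc" "\<And>j. \<phi> (e j) = w j" "\<And>x. cmod (\<phi> x) \<le> dual_seq_norm sc e N w * N x"
proof -
  obtain \<phi> where \<phi>: "\<phi> \<in> dual sc" "\<And>j. \<phi> (e j) = w j"
    using assms by (auto simp: dual_seq_space_def)
  have "(THE \<phi>. \<phi> \<in> dual sc \<and> (\<forall>j. \<phi> (e j) = w j)) = \<phi>"
    using \<phi> by (intro the_equality) (auto intro!: dual_eqI)
  then have eq: "dual_seq_norm sc e N w = (SUP x\<in>{x. N x \<le> 1}. cmod (\<phi> x))"
    by (simp add: dual_seq_norm_def)
  have b: "bounded_linear \<phi>" and s: "\<And>c x. \<phi> (sc c x) = c * \<phi> x" using \<phi> by (auto simp: dual_def)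
  obtain K where K: "0 < K" "\<And>x. cmod (\<phi> x) \<le> norm x * K" using bounded_linear.pos_bounded[OF b] by blast
  obtain \<alpha> \<beta> where ab: "0 < \<alpha>" "\<And>x. \<alpha> * norm x \<le> N x" using norm_bounds by metis
  have bdd: "bdd_above ((\<lambda>x. cmod (\<phi> x)) ` {x. N x \<le> 1})"
  proof (rule bdd_aboveI2)
    fix x assume "x \<in> {x. N x \<le> 1}"
    then have "norm x \<le> 1 / \<alpha>" using ab(2)[of x] ab(1) by (simp add: field_simps)
    then show "cmod (\<phi> x) \<le> 1 / \<alpha> * K" using K(2)[of x] K(1) by (meson mult_right_mono order_trans less_imp_le)
  qed
  have Nsc: "N (sc c x) = cmod c * N x" for c x using equivalent by (simp add: equivalent_norm_def)
  have "cmod (\<phi> x) \<le> dual_seq_norm sc e N w * N x" for x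
  proof (cases "N x = 0")
    case True
    then have "x = 0" using ab(2)[of x] ab(1) by (simp add: mult_le_0_iff)
    then have "\<phi> x = 0" using linear_0[OF bounded_linear.linear[OF b]] by simp
    then show ?thesis using True by simp
  next
    case False
    then have Nx: "0 < N x" using N_nonneg[of x] by simp
    have "cmod (\<phi> (sc (complex_of_real (1 / N x)) x)) \<le> dual_seq_norm sc e N w"
      unfolding eq using Nx by (intro cSUP_upper bdd) (simp add: Nsc norm_divide)
    then show ?thesis using Nx by (simp add: s norm_mult norm_divide field_simps)
  qed
  with \<phi> show thesis using that by blast
qed

text \<open>Replacing each v i by |v i| times the conjugate sign of w i makes all products
  nonnegative, and one-unconditionality ensures that this does not increase N.\<close>

lemma duality_bound:
  assumes "v \<in> c00" "w \<in> dual_seq_space sc e" "dual_seq_norm sc e N w \<le> 1" "finite F" "supp v \<subseteq> F"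
  shows "(\<Sum>i\<in>F. cmod (v i) * cmod (w i)) \<le> N (synth sc e v)"
proof -
  obtain \<phi> where \<phi>: "\<phi> \<in> dual sc" "\<And>j. \<phi> (e j) = w j" "\<And>x. cmod (\<phi> x) \<le> dual_seq_norm sc e N w * N x"
    using dual_seq_functional[OF assms(2)] by blast
  have b: "bounded_linear \<phi>" and s: "\<And>c x. \<phi> (sc c x) = c * \<phi> x" using \<phi> by (auto simp: dual_def)
  define a where "a = (\<lambda>i. complex_of_real (cmod (v i)) * sgn (cnj (w i)))"
  have sa: "supp a \<subseteq> F" using assms(5) by (auto simp: a_def supp_def)
  then have a: "a \<in> c00" using assms(4) finite_subset by (auto simp: c00_def)
  have av: "cmod (a j) \<le> cmod (v j)" for j
    by (simp add: a_def norm_mult norm_sgn)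
  have "a i * w i = complex_of_real (cmod (v i) * cmod (w i))" for i
  proof (cases "w i = 0")
    case False
    then have "sgn (cnj (w i)) * w i = complex_of_real (cmod (w i))"
      by (simp add: sgn_eq complex_norm_square[symmetric] mult.commute[of "cnj _"] power2_eq_square field_simps)
    then show ?thesis by (simp add: a_def mult.assoc)
  qed simp
  then have "complex_of_real (\<Sum>i\<in>F. cmod (v i) * cmod (w i)) = (\<Sum>i\<in>F. a i * \<phi> (e i))" by (simp add: \<phi>(2))
  also have "\<dots> = \<phi> (synth sc e a)"
    unfolding synth_finite(2)[OF assms(4) sa] linear_sum[OF bounded_linear.linear[OF b]] s ..
  finally have "cmod (\<phi> (synth sc e a)) = \<bar>\<Sum>i\<in>F. cmod (v i) * cmod (w i)\<bar>" by (metis norm_of_real)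
  then have "(\<Sum>i\<in>F. cmod (v i) * cmod (w i)) \<le> dual_seq_norm sc e N w * N (synth sc e a)"
    using \<phi>(3)[of "synth sc e a"] by simp
  also have "\<dots> \<le> 1 * N (synth sc e a)" using assms(3) N_nonneg by (intro mult_right_mono) auto
  also have "\<dots> \<le> N (synth sc e v)" using N_synth_mono[OF a assms(1) av] by simp
  finally show ?thesis .
qed

abbreviation "factorization \<equiv> lozanovskii_factorization (seq_space sc e) (seq_norm sc e N)
   (dual_seq_space sc e) (dual_seq_norm sc e N)"

end

lemma block_sum_value:
  assumes "finite J" "disjoint_family_on (\<lambda>j. supp (U j)) J" "\<And>k. k \<in> J \<Longrightarrow> supp (G k) \<subseteq> supp (U k)"
    and "j \<in> J" "i \<in> supp (U j)"
  shows "(\<Sum>k\<in>J. seq_scale (a k) (G k)) i = a j * G j i"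
proof -
  have "G k i = 0" if "k \<in> J" "k \<noteq> j" for k
  proof -
    have "supp (U k) \<inter> supp (U j) = {}" using assms(2,4) that by (simp add: disjoint_family_on_def)
    then have "i \<notin> supp (G k)" using assms(3)[OF that(1)] assms(5) by blast
    then show ?thesis by (simp add: supp_def)
  qed
  then have "(\<Sum>k\<in>J. a k * G k i) = (\<Sum>k\<in>{j}. a k * G k i)"
    using assms(1,4) by (intro sum.mono_neutral_right) auto
  then show ?thesis by (simp add: sum_fun_apply)
qed

lemma block_sum_outside:
  assumes "\<And>k. k \<in> J \<Longrightarrow> supp (G k) \<subseteq> supp (U k)" "i \<notin> (\<Union>k\<in>J. supp (U k))"
  shows "(\<Sum>k\<in>J. seq_scale (a k) (G k)) i = 0"
  unfolding sum_fun_apply using assms by (intro sum.neutral) (force simp: supp_def)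

lemma l2_norm_block_sum:
  assumes "finite J" "disjoint_family_on (\<lambda>j. supp (U j)) J" "\<And>j. j \<in> J \<Longrightarrow> U j \<in> c00 \<and> l2_norm (U j) = 1"
  shows "l2_norm (\<Sum>j\<in>J. seq_scale (a j) (U j)) = L2_set (\<lambda>j. cmod (a j)) J"
proof -
  let ?y = "\<Sum>j\<in>J. seq_scale (a j) (U j)"
  have fin: "finite (\<Union>j\<in>J. supp (U j))" using assms by (auto simp: c00_def)
  have 1: "(\<Sum>i\<in>supp (U j). (cmod (U j i))\<^sup>2) = 1" if "j \<in> J" for j
  proof -
    have "l2_norm (U j) = L2_set (\<lambda>i. cmod (U j i)) (supp (U j))"
      using assms(3)[OF that] by (intro l2_norm_finite) (auto simp: c00_def supp_def)
    then show ?thesis using assms(3)[OF that] by (simp add: L2_set_def)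
  qed
  have "(\<Sum>i\<in>(\<Union>j\<in>J. supp (U j)). (cmod (?y i))\<^sup>2) = (\<Sum>j\<in>J. \<Sum>i\<in>supp (U j). (cmod (?y i))\<^sup>2)"
    using assms by (intro sum.UNION_disjoint) (auto simp: c00_def disjoint_family_on_def)
  also have "\<dots> = (\<Sum>j\<in>J. \<Sum>i\<in>supp (U j). (cmod (a j))\<^sup>2 * (cmod (U j i))\<^sup>2)"
    by (intro sum.cong refl) (simp add: block_sum_value[OF assms(1,2) order_refl] norm_mult power_mult_distrib)
  also have "\<dots> = (\<Sum>j\<in>J. (cmod (a j))\<^sup>2)" by (simp add: sum_distrib_left[symmetric] 1)
  finally have "L2_set (\<lambda>i. cmod (?y i)) (\<Union>j\<in>J. supp (U j)) = L2_set (\<lambda>j. cmod (a j)) J"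
    by (simp add: L2_set_def)
  moreover have "l2_norm ?y = L2_set (\<lambda>i. cmod (?y i)) (\<Union>j\<in>J. supp (U j))"
    by (rule l2_norm_finite[OF fin block_sum_outside[OF order_refl]])
  ultimately show ?thesis by simp
qed


section \<open>Blocks in an asymptotic space\<close>

text \<open>Normalization is dropped because this is applied to the factors V j and to pieces of
  \<open>v\<close>, whose norms vary. Nonzero vectors are demanded so that the order of neighbours
  extends to all pairs.\<close>

definition far_blocks :: "nat \<Rightarrow> (nat \<Rightarrow> cseq) \<Rightarrow> bool" where
  "far_blocks n U \<longleftrightarrow> (\<forall>j<n. U j \<in> c00 \<and> U j \<noteq> 0 \<and> (\<forall>i\<in>supp (U j). n \<le> i)) \<and>
     (\<forall>j. Suc j < n \<longrightarrow> block_less (U j) (U (Suc j)))"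

lemma supp_eq_empty: "supp u = {} \<longleftrightarrow> u = 0"
  by (auto simp: supp_def fun_eq_iff)

lemma far_blocks_cong:
  assumes "far_blocks n U" "\<And>j. j < n \<Longrightarrow> supp (G j) = supp (U j)"
  shows "far_blocks n G"
  using assms unfolding far_blocks_def block_less_def c00_def supp_eq_empty[symmetric] by auto

text \<open>\<open>block_less\<close> holds vacuously for the zero vector and is therefore not
  transitive; a nonzero intermediate vector supplies the index that links two comparisons.\<close>

lemma block_less_chain:
  assumes "\<And>j. j < n \<Longrightarrow> U j \<noteq> 0" "\<And>j. Suc j < n \<Longrightarrow> block_less (U j) (U (Suc j))" "i < j" "j < n"
  shows "block_less (U i) (U j)"
  using assms(3,4)
proof (induction j)
  case (Suc j)
  show ?case
  proof (cases "i = j")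
    case True
    then show ?thesis using assms(2) Suc by simp
  next
    case False
    then have 1: "block_less (U i) (U j)" using Suc by simp
    have 2: "block_less (U j) (U (Suc j))" using assms(2) Suc by simp
    obtain l where "l \<in> supp (U j)" using assms(1)[of j] Suc.prems supp_eq_empty[of "U j"] by auto
    then show ?thesis using 1 2 unfolding block_less_def by (meson less_trans)
  qed
qed simp

lemma far_blocks_disjoint:
  assumes "far_blocks n U"
  shows "disjoint_family_on (\<lambda>j. supp (U j)) {..<n}"
  unfolding disjoint_family_on_def
proof (intro ballI impI)
  fix i j assume ij: "i \<in> {..<n}" "j \<in> {..<n}" "i \<noteq> j"
  have *: "block_less (U i) (U j)" if "i < j" "j < n" for i j
    by (rule block_less_chain[of n U, OF _ _ that]) (use assms in \<open>auto simp: far_blocks_def\<close>)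
  from ij have "block_less (U i) (U j) \<or> block_less (U j) (U i)"
    using *[of i j] *[of j i] by (cases "i < j") auto
  then show "supp (U i) \<inter> supp (U j) = {}"
    unfolding block_less_def by blast
qed

context one_unconditional_space
begin

text \<open>The norms of the blocks are moved into the coefficients; they are positive because
  \<open>synth\<close> is injective on \<open>c00\<close>.\<close>

lemma asymptotic_lp_far_blocks:
  assumes "asymptotic_lp sc e p"
  obtains C where "0 < C" "\<And>n U c. far_blocks n U \<Longrightarrow>
     (\<Sum>j<n. (cmod (c j) * norm (synth sc e (U j))) powr p) powr (1 / p) / C
       \<le> norm (synth sc e (\<Sum>j<n. seq_scale (c j) (U j))) \<and>
     norm (synth sc e (\<Sum>j<n. seq_scale (c j) (U j)))
       \<le> C * (\<Sum>j<n. (cmod (c j) * norm (synth sc e (U j))) powr p) powr (1 / p)"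
proof -
  from assms obtain C where C: "0 < C" "\<forall>n u.
        (\<forall>j<n. u j \<in> c00 \<and> norm (synth sc e (u j)) = 1 \<and> (\<forall>i\<in>supp (u j). n \<le> i)) \<and>
        (\<forall>j. Suc j < n \<longrightarrow> block_less (u j) (u (Suc j))) \<longrightarrow>
        (\<forall>c. (\<Sum>j<n. cmod (c j) powr p) powr (1 / p) / C
             \<le> norm (\<Sum>j<n. sc (c j) (synth sc e (u j))) \<and>
           norm (\<Sum>j<n. sc (c j) (synth sc e (u j)))
             \<le> C * (\<Sum>j<n. cmod (c j) powr p) powr (1 / p))"
    unfolding asymptotic_lp_def by (elim exE conjE)
  show thesis
  proof (rule that[OF C(1)])
    fix n U and c :: "nat \<Rightarrow> complex" assume U: "far_blocks n U"
    define r where "r j = norm (synth sc e (U j))" for j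
    define u where "u j = seq_scale (complex_of_real (1 / r j)) (U j)" for j
    have r: "0 < r j" "U j \<in> c00" if "j < n" for j
      using U that synth_eq_0[of "U j"] by (auto simp: r_def far_blocks_def)
    have su: "supp (u j) = supp (U j)" if "j < n" for j
      using r[OF that] by (auto simp: u_def supp_def)
    then have fu: "far_blocks n u" using far_blocks_cong[OF U] by blast
    have synu: "synth sc e (u j) = sc (complex_of_real (1 / r j)) (synth sc e (U j))" if "j < n" for j
      unfolding u_def using r that by (intro synth_scale) auto
    have nu: "norm (synth sc e (u j)) = 1" if "j < n" for j
      using r[OF that] by (simp add: synu[OF that] norm_scale norm_divide r_def[symmetric])
    have eq: "(\<Sum>j<n. sc (c j * complex_of_real (r j)) (synth sc e (u j))) = synth sc e (\<Sum>j<n. seq_scale (c j) (U j))"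
    proof -
      have "synth sc e (\<Sum>j<n. seq_scale (c j) (U j)) = (\<Sum>j<n. sc (c j) (synth sc e (U j)))"
        using r by (intro synth_sum) auto
      also have "\<dots> = (\<Sum>j<n. sc (c j * complex_of_real (r j)) (synth sc e (u j)))"
      proof (intro sum.cong refl)
        fix j assume "j \<in> {..<n}"
        then have "j < n" by simp
        show "sc (c j) (synth sc e (U j)) = sc (c j * complex_of_real (r j)) (synth sc e (u j))"
          using r(1)[OF \<open>j < n\<close>] by (simp add: synu[OF \<open>j < n\<close>])
      qed
      finally show ?thesis by simp
    qed
    have ab: "cmod (c j * complex_of_real (r j)) = cmod (c j) * norm (synth sc e (U j))" for j
      by (simp add: norm_mult r_def)
    show "(\<Sum>j<n. (cmod (c j) * norm (synth sc e (U j))) powr p) powr (1 / p) / C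
       \<le> norm (synth sc e (\<Sum>j<n. seq_scale (c j) (U j))) \<and>
     norm (synth sc e (\<Sum>j<n. seq_scale (c j) (U j)))
       \<le> C * (\<Sum>j<n. (cmod (c j) * norm (synth sc e (U j))) powr p) powr (1 / p)"
      using C(2)[rule_format, of n u "\<lambda>j. c j * complex_of_real (r j)"] fu nu
      unfolding eq ab far_blocks_def by blast
  qed
qed

text \<open>The core estimate. Derivatives already appear as u (ln |w| - ln |v|), so only lattice
  and duality estimates remain, and D is fixed before n, the blocks and the factorizations.\<close>

lemma block_stability:
  assumes p: "1 \<le> p" and "asymptotic_lp sc e p"
  obtains D where "0 \<le> D" "\<And>n U b V W y v w. far_blocks n U \<Longrightarrow>
     (\<And>j. j < n \<Longrightarrow> factorization (U j) (V j) (W j)) \<Longrightarrow> (\<Sum>j<n. (cmod (b j))\<^sup>2) = 1 \<Longrightarrow>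
     y = (\<Sum>j<n. seq_scale (b j) (U j)) \<Longrightarrow> factorization y v w \<Longrightarrow>
     l2_norm ((\<Sum>j<n. seq_scale (b j) (\<lambda>i. U j i * complex_of_real (ln (cmod (W j i)) - ln (cmod (V j i)))))
        - (\<lambda>i. y i * complex_of_real (ln (cmod (w i)) - ln (cmod (v i))))
        + (\<Sum>j<n. seq_scale (b j * complex_of_real ((2 - 4 / p) * ln (cmod (b j)))) (U j))) \<le> D"
proof -
  obtain C where C: "0 < C" and asym: "\<And>n U c. far_blocks n U \<Longrightarrow>
     (\<Sum>j<n. (cmod (c j) * norm (synth sc e (U j))) powr p) powr (1 / p) / C
       \<le> norm (synth sc e (\<Sum>j<n. seq_scale (c j) (U j))) \<and>
     norm (synth sc e (\<Sum>j<n. seq_scale (c j) (U j)))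
       \<le> C * (\<Sum>j<n. (cmod (c j) * norm (synth sc e (U j))) powr p) powr (1 / p)"
    using asymptotic_lp_far_blocks[OF assms(2)] by blast
  obtain \<alpha> \<beta> where ab: "0 < \<alpha>" "0 < \<beta>" "\<And>x. \<alpha> * norm x \<le> N x" "\<And>x. N x \<le> \<beta> * norm x"
    using norm_bounds by blast
  \<comment> \<open>1/\<alpha> bounds the original norm on the unit ball of N, C is the asymptotic
    constant, and \<beta> leads back from the norm to N.\<close>
  define K where "K = \<beta> * (C * (1 / \<alpha>))"
  have K: "0 < K" using ab C by (simp add: K_def)
  have small: "norm x \<le> 1 / \<alpha>" if "N x \<le> 1" for x
    using ab(3)[of x] ab(1) that by (simp add: field_simps)
  show thesis
  proof (rule that[of "sqrt (16 * K)"])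
    fix n U b V W y v w
    assume U: "far_blocks n U" and fact: "\<And>j. j < n \<Longrightarrow> factorization (U j) (V j) (W j)"
      and b1: "(\<Sum>j<n. (cmod (b j))\<^sup>2) = 1" and y: "y = (\<Sum>j<n. seq_scale (b j) (U j))"
      and facty: "factorization y v w"
    let ?J = "{..<n}"
    define T where "T = (\<Union>j\<in>?J. supp (U j))"
    define S where "S = supp y"
    have Uc: "U j \<in> c00" if "j < n" for j using U that by (simp add: far_blocks_def)
    have yc: "y \<in> c00" unfolding y using Uc by (intro c00_sum c00_scale) auto
    note disj = far_blocks_disjoint[OF U]
    have T: "finite T" using Uc by (auto simp: T_def c00_def)
    have VW: "V j \<in> c00" "supp (V j) = supp (U j)" "supp (W j) = supp (U j)" "N (synth sc e (V j)) \<le> 1"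
      "W j \<in> dual_seq_space sc e" "dual_seq_norm sc e N (W j) \<le> 1"
      "(cmod (U j i))\<^sup>2 = cmod (V j i) * cmod (W j i)" if "j < n" for j i
      using fact[OF that] Uc[OF that] by (auto simp: lozanovskii_factorization_def seq_norm_def c00_def)
    have vw: "v \<in> c00" "supp v = S" "supp w = S" "N (synth sc e v) \<le> 1"
      "w \<in> dual_seq_space sc e" "dual_seq_norm sc e N w \<le> 1"
      "(cmod (y i))\<^sup>2 = cmod (v i) * cmod (w i)" for i
      using facty yc by (auto simp: lozanovskii_factorization_def seq_norm_def c00_def S_def)
    have val: "(\<Sum>k<n. seq_scale (a k) (G k)) i = a j * G j i"
      if "\<And>k. k < n \<Longrightarrow> supp (G k) \<subseteq> supp (U k)" "j < n" "i \<in> supp (U j)" for a G j i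
      using block_sum_value[OF finite_lessThan disj, of G j i a] that by auto
    have out: "(\<Sum>k<n. seq_scale (a k) (G k)) i = 0"
      if "\<And>k. k < n \<Longrightarrow> supp (G k) \<subseteq> supp (U k)" "i \<notin> T" for a G i
      using block_sum_outside[of ?J G U i a] that by (auto simp: T_def)
    have yval: "y i = b j * U j i" if "j < n" "i \<in> supp (U j)" for i j
      unfolding y using that by (intro val) auto
    have ST: "S \<subseteq> T"
    proof
      fix i assume "i \<in> S"
      then show "i \<in> T" using out[of U i b] by (auto simp: S_def supp_def y)
    qed
    then have S: "finite S" using T finite_subset by blast
    have Sblock: "\<exists>j<n. i \<in> supp (U j) \<and> b j \<noteq> 0" if iS: "i \<in> S" for i
    proof -
      obtain j where j: "j < n" "i \<in> supp (U j)" using iS ST by (auto simp: T_def)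
      then have "b j \<noteq> 0" using iS yval[OF j] by (auto simp: S_def supp_def)
      then show ?thesis using j by blast
    qed
    \<comment> \<open>Weights of total mass 1. Their powers 1/p and 1 - 1/p multiply to x j, as
      needed for |y|^2 = x j |U j|^2 on the j-th block.\<close>
    define x where "x j = (cmod (b j))\<^sup>2" for j
    define v' where "v' = (\<Sum>j<n. seq_scale (complex_of_real (x j powr (1 / p))) (V j))"
    define w' where "w' = (\<Sum>j<n. seq_scale (complex_of_real (x j powr (1 - 1 / p))) (W j))"
    have v'val: "v' i = complex_of_real (x j powr (1 / p)) * V j i"
      and w'val: "w' i = complex_of_real (x j powr (1 - 1 / p)) * W j i" if "j < n" "i \<in> supp (U j)" for i j
      unfolding v'_def w'_def using that VW by (auto intro!: val)
    \<comment> \<open>First cross pairing: \<open>w\<close> acts on v' with norm at most 1, and the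
      upper estimate applies to v', the p-th powers of its coefficients having sum 1.\<close>
    have "(\<Sum>i\<in>S. cmod (w i) * cmod (v' i)) \<le> (\<Sum>i\<in>T. cmod (v' i) * cmod (w i))"
      using ST T by (subst mult.commute) (intro sum_mono2, auto)
    also have "\<dots> \<le> N (synth sc e v')"
    proof (rule duality_bound[OF _ vw(5,6) T])
      show "v' \<in> c00" unfolding v'_def using VW by (intro c00_sum c00_scale) auto
      show "supp v' \<subseteq> T"
      proof
        fix i assume "i \<in> supp v'"
        then show "i \<in> T" using out[of V i] VW(2) unfolding v'_def supp_def by fastforce
      qed
    qed
    also have "\<dots> \<le> \<beta> * norm (synth sc e v')" by (rule ab)
    also have "norm (synth sc e v') \<le> C * (1 / \<alpha>)"
    proof -
      have "far_blocks n V" using far_blocks_cong[OF U VW(2)] .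
      then have "norm (synth sc e v')
        \<le> C * (\<Sum>j<n. (cmod (complex_of_real (x j powr (1 / p))) * norm (synth sc e (V j))) powr p) powr (1 / p)"
        unfolding v'_def by (rule asym[THEN conjunct2])
      moreover have "(\<Sum>j<n. (cmod (complex_of_real (x j powr (1 / p))) * norm (synth sc e (V j))) powr p)
         \<le> (\<Sum>j<n. x j * (1 / \<alpha>) powr p)"
      proof (rule sum_mono)
        fix j assume "j \<in> ?J"
        then have "norm (synth sc e (V j)) \<le> 1 / \<alpha>" using VW(4) small by simp
        then have "(x j powr (1 / p) * norm (synth sc e (V j))) powr p \<le> (x j powr (1 / p) * (1 / \<alpha>)) powr p"
          using p by (intro powr_mono2 mult_left_mono) auto
        also have "\<dots> = x j * (1 / \<alpha>) powr p"
          using p ab(1) by (subst powr_mult) (auto simp: powr_powr x_def)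
        finally show "(cmod (complex_of_real (x j powr (1 / p))) * norm (synth sc e (V j))) powr p \<le> x j * (1 / \<alpha>) powr p"
          by simp
      qed
      then have "C * (\<Sum>j<n. (cmod (complex_of_real (x j powr (1 / p))) * norm (synth sc e (V j))) powr p) powr (1 / p)
        \<le> C * (\<Sum>j<n. x j * (1 / \<alpha>) powr p) powr (1 / p)"
        using C p by (intro mult_left_mono powr_mono2 sum_nonneg) auto
      moreover have "(\<Sum>j<n. x j * (1 / \<alpha>) powr p) = (1 / \<alpha>) powr p"
        using b1 by (simp add: sum_distrib_right[symmetric] x_def)
      moreover have "((1 / \<alpha>) powr p) powr (1 / p) = 1 / \<alpha>" using p ab(1) by (simp add: powr_powr)
      ultimately show ?thesis by simp
    qed
    finally have claim1: "(\<Sum>i\<in>S. cmod (w i) * cmod (v' i)) \<le> K" using ab by (simp add: K_def)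

    \<comment> \<open>Second cross pairing: \<open>v\<close> is cut into pieces R j, and each W j
      acts only on its own piece. Hoelder's inequality recombines the norms s j, and the lower
      estimate bounds their p-norm by that of \<open>v\<close>.\<close>
    define R where "R j = (\<lambda>i. if i \<in> supp (U j) then v i else 0)" for j
    define s where "s j = norm (synth sc e (R j))" for j
    have Rc: "R j \<in> c00" for j
      using vw(1) unfolding c00_def R_def by (auto intro: finite_subset simp: supp_def)
    have v0: "v i = 0" if "j < n" "i \<in> supp (U j)" "b j = 0" for i j
      using yval[OF that(1,2)] that(3) vw(2) by (auto simp: S_def supp_def)
    have "(\<Sum>i\<in>S. cmod (w' i) * cmod (v i)) \<le> (\<Sum>i\<in>T. cmod (w' i) * cmod (v i))"
      using ST T by (intro sum_mono2) auto
    also have "\<dots> = (\<Sum>j<n. \<Sum>i\<in>supp (U j). cmod (w' i) * cmod (v i))"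
      unfolding T_def using Uc disj by (intro sum.UNION_disjoint) (auto simp: c00_def disjoint_family_on_def)
    also have "\<dots> = (\<Sum>j<n. x j powr (1 - 1 / p) * (\<Sum>i\<in>supp (U j). cmod (R j i) * cmod (W j i)))"
      unfolding sum_distrib_left by (intro sum.cong refl) (auto simp: w'val R_def norm_mult)
    also have "\<dots> \<le> (\<Sum>j<n. x j powr (1 - 1 / p) * (\<beta> * s j))"
    proof (intro sum_mono mult_left_mono)
      fix j assume "j \<in> ?J"
      then have j: "j < n" by simp
      have "(\<Sum>i\<in>supp (U j). cmod (R j i) * cmod (W j i)) \<le> N (synth sc e (R j))"
        using Uc[OF j] by (intro duality_bound Rc VW j) (auto simp: R_def supp_def c00_def)
      also have "\<dots> \<le> \<beta> * s j" unfolding s_def by (rule ab)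
      finally show "(\<Sum>i\<in>supp (U j). cmod (R j i) * cmod (W j i)) \<le> \<beta> * s j" .
    qed auto
    also have "\<dots> = \<beta> * (\<Sum>j<n. x j powr (1 - 1 / p) * s j)"
      by (simp add: sum_distrib_left mult_ac)
    also have "\<dots> \<le> \<beta> * (\<Sum>j<n. s j powr p) powr (1 / p)"
      using p b1 ab(2) by (intro mult_left_mono Hoelder_sum_powr) (auto simp: x_def s_def)
    also have "(\<Sum>j<n. s j powr p) powr (1 / p) \<le> C * (1 / \<alpha>)"
    proof -
      \<comment> \<open>If b j = 0, the piece R j is zero and not admissible in
        \<open>far_blocks\<close>; U j stands in for it with coefficient 0.\<close>
      define G where "G j = (if b j = 0 then U j else R j)" for j
      define c where "c j = (if b j = 0 then 0 else 1 :: complex)" for j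
      have G: "supp (G j) = supp (U j)" if "j < n" for j
        using yval[OF that] vw(2) by (auto simp: G_def R_def supp_def S_def)
      have "v = (\<Sum>j<n. seq_scale (c j) (G j))"
      proof
        fix i show "v i = (\<Sum>j<n. seq_scale (c j) (G j)) i"
        proof (cases "i \<in> T")
          case True
          then obtain j where j: "j < n" "i \<in> supp (U j)" by (auto simp: T_def)
          show ?thesis using val[of G j i c] G j v0[OF j] by (auto simp: c_def G_def R_def)
        next
          case False
          then have "v i = 0" using ST vw(2) by (auto simp: supp_def)
          then show ?thesis using out[of G i c] G False by auto
        qed
      qed
      moreover have "far_blocks n G" using far_blocks_cong[OF U G] .
      ultimately have "(\<Sum>j<n. (cmod (c j) * norm (synth sc e (G j))) powr p) powr (1 / p) / C \<le> norm (synth sc e v)"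
        using asym[of n G c] by simp
      moreover have "(\<Sum>j<n. (cmod (c j) * norm (synth sc e (G j))) powr p) = (\<Sum>j<n. s j powr p)"
      proof (intro sum.cong refl)
        fix j assume "j \<in> ?J"
        then have j: "j < n" by simp
        show "(cmod (c j) * norm (synth sc e (G j))) powr p = s j powr p"
        proof (cases "b j = 0")
          case True
          then have "R j = 0" using v0[OF j] by (auto simp: R_def fun_eq_iff)
          then show ?thesis using True by (simp add: c_def s_def synth_zero)
        qed (simp add: c_def G_def s_def)
      qed
      moreover have "norm (synth sc e v) \<le> 1 / \<alpha>" using small vw(4) by blast
      ultimately have "(\<Sum>j<n. s j powr p) powr (1 / p) / C \<le> 1 / \<alpha>" by simp
      then show ?thesis using C by (simp add: field_simps)
    qed
    finally have claim2: "(\<Sum>i\<in>S. cmod (w' i) * cmod (v i)) \<le> K" using ab by (simp add: K_def)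

    define g where "g i = (ln (cmod (w' i)) - ln (cmod (v' i))) - (ln (cmod (w i)) - ln (cmod (v i)))" for i
    let ?E = "(\<Sum>j<n. seq_scale (b j) (\<lambda>i. U j i * complex_of_real (ln (cmod (W j i)) - ln (cmod (V j i)))))
        - (\<lambda>i. y i * complex_of_real (ln (cmod (w i)) - ln (cmod (v i))))
        + (\<Sum>j<n. seq_scale (b j * complex_of_real ((2 - 4 / p) * ln (cmod (b j)))) (U j))"
    have Eval: "?E i = b j * U j i * complex_of_real (ln (cmod (W j i)) - ln (cmod (V j i)) -
         (ln (cmod (w i)) - ln (cmod (v i))) + (2 - 4 / p) * ln (cmod (b j)))"
      if j: "j < n" "i \<in> supp (U j)" for i j
    proof -
      have 1: "(\<Sum>j<n. seq_scale (b j) (\<lambda>i. U j i * complex_of_real (ln (cmod (W j i)) - ln (cmod (V j i))))) i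
         = b j * (U j i * complex_of_real (ln (cmod (W j i)) - ln (cmod (V j i))))"
        using j by (intro val) (auto simp: supp_def)
      have 2: "(\<Sum>j<n. seq_scale (b j * complex_of_real ((2 - 4 / p) * ln (cmod (b j)))) (U j)) i
         = (b j * complex_of_real ((2 - 4 / p) * ln (cmod (b j)))) * U j i"
        using j by (intro val) auto
      show ?thesis unfolding plus_fun_apply minus_apply 1 2 yval[OF j]
        by (simp add: algebra_simps)
    qed
    have pos: "0 < cmod (v i) \<and> 0 < cmod (w i) \<and> 0 < cmod (v' i) \<and> 0 < cmod (w' i) \<and>
        cmod (v i) * cmod (w i) = cmod (v' i) * cmod (w' i)"
      and Eg: "?E i = y i * complex_of_real (g i)" if i: "i \<in> S" for i
    proof -
      obtain j where j: "j < n" "i \<in> supp (U j)" "b j \<noteq> 0" using Sblock[OF i] by blast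
      have x: "0 < x j" using j by (simp add: x_def)
      have nz: "V j i \<noteq> 0" "W j i \<noteq> 0" "v i \<noteq> 0" "w i \<noteq> 0"
        using j i VW(2,3)[OF j(1)] vw(2,3) by (auto simp: supp_def)
      have cv': "cmod (v' i) = x j powr (1 / p) * cmod (V j i)"
        and cw': "cmod (w' i) = x j powr (1 - 1 / p) * cmod (W j i)"
        by (simp_all add: v'val[OF j(1,2)] w'val[OF j(1,2)] norm_mult)
      have "cmod (v i) * cmod (w i) = x j * (cmod (V j i) * cmod (W j i))"
        using vw(7)[of i] VW(7)[OF j(1), of i] by (simp add: yval[OF j(1,2)] norm_mult power_mult_distrib x_def)
      also have "x j = x j powr (1 / p) * x j powr (1 - 1 / p)"
        using x by (simp add: powr_add[symmetric])
      finally show "0 < cmod (v i) \<and> 0 < cmod (w i) \<and> 0 < cmod (v' i) \<and> 0 < cmod (w' i) \<and>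
        cmod (v i) * cmod (w i) = cmod (v' i) * cmod (w' i)"
        unfolding cv' cw' using nz x by (simp add: mult_ac)
      have lx: "ln (x j) = 2 * ln (cmod (b j))" using j(3) by (simp add: x_def ln_realpow)
      \<comment> \<open>The exponents of x j differ by 1 - 2/p, and ln (x j) is twice ln |b j|: this
        is the origin of 2 - 4/p.\<close>
      have "ln (cmod (w' i)) - ln (cmod (v' i)) = ln (cmod (W j i)) - ln (cmod (V j i)) + (1 - 2 / p) * ln (x j)"
        unfolding cv' cw' using nz x by (simp add: ln_mult ln_powr algebra_simps)
      then have "g i = ln (cmod (W j i)) - ln (cmod (V j i)) -
         (ln (cmod (w i)) - ln (cmod (v i))) + (2 - 4 / p) * ln (cmod (b j))"
        by (simp add: g_def lx algebra_simps)
      then show "?E i = y i * complex_of_real (g i)"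
        using Eval[OF j(1,2)] yval[OF j(1,2)] by simp
    qed
    \<comment> \<open>Logarithms of 0 may occur here within a block, but they are multiplied by the
      vanishing product b j U j i.\<close>
    have E0: "?E i = 0" if "i \<notin> S" for i
    proof (cases "i \<in> T")
      case True
      then obtain j where j: "j < n" "i \<in> supp (U j)" by (auto simp: T_def)
      have "b j * U j i = 0" using that yval[OF j] by (simp add: S_def supp_def)
      then show ?thesis using Eval[OF j] by simp
    next
      case False
      have "(\<Sum>j<n. seq_scale (b j) (\<lambda>i. U j i * complex_of_real (ln (cmod (W j i)) - ln (cmod (V j i))))) i = 0"
        using False by (intro out) (auto simp: supp_def)
      moreover have "(\<Sum>j<n. seq_scale (b j * complex_of_real ((2 - 4 / p) * ln (cmod (b j)))) (U j)) i = 0"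
        using False by (intro out) auto
      moreover have "y i = 0" using that by (simp add: S_def supp_def)
      ultimately show ?thesis unfolding plus_fun_apply minus_apply by simp
    qed
    have "l2_norm ?E = L2_set (\<lambda>i. cmod (?E i)) S" by (rule l2_norm_finite[OF S E0])
    also have "\<dots> = sqrt (\<Sum>i\<in>S. cmod (v i) * cmod (w i) * (g i)\<^sup>2)"
      unfolding L2_set_def
      by (intro arg_cong[of _ _ sqrt] sum.cong refl) (simp only: Eg norm_mult power_mult_distrib vw(7) norm_of_real power2_abs)
    also have "\<dots> \<le> sqrt (16 * K)"
      unfolding g_def by (intro real_sqrt_le_mono factorization_stability pos claim1 claim2)
    finally show "l2_norm ?E \<le> sqrt (16 * K)" .
  qed (use K in simp)
qed

end


section \<open>The derivation on block sums\<close>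

text \<open>The selection is described on the strip only; since 1/2 is an interior point, this
  determines the derivative there.\<close>

lemma eventually_strip: "\<forall>\<^sub>F z in nhds (1 / 2). z \<in> strip"
proof -
  have "open {z. 0 < Re z \<and> Re z < 1}"
    by (intro open_Collect_conj open_Collect_less continuous_intros)
  moreover have "1 / 2 \<in> {z. 0 < Re z \<and> Re z < 1}" by simp
  ultimately have "\<forall>\<^sub>F z in nhds (1 / 2). z \<in> {z. 0 < Re z \<and> Re z < 1}"
    by (rule eventually_nhds_in_open)
  then show ?thesis by eventually_elim (auto simp: strip_def)
qed

lemma half_in_interior_strip: "1 / 2 \<in> interior strip"
  using eventually_strip unfolding eventually_nhds interior_def by blast

lemma derivation_scale:
  assumes "selection V0 N0 V1 N1 B" "x \<in> l2"
  shows "derivation B (seq_scale c x) = seq_scale c (derivation B x)"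
proof
  fix j
  have hom: "B (seq_scale c x) z j = c * B x z j" if "z \<in> strip" for z
    using assms that by (simp add: selection_def)
  have "(\<lambda>z. B x z j) holomorphic_on interior strip"
    using assms by (auto simp: selection_def F_infty_def)
  then have "(\<lambda>z. B x z j) field_differentiable at (1 / 2)"
    using half_in_interior_strip holomorphic_on_imp_differentiable_at open_interior by blast
  then have "deriv (\<lambda>z. c * B x z j) (1 / 2) = c * deriv (\<lambda>z. B x z j) (1 / 2)"
    by (rule deriv_cmult)
  moreover have "deriv (\<lambda>z. B (seq_scale c x) z j) (1 / 2) = deriv (\<lambda>z. c * B x z j) (1 / 2)"
    using eventually_strip by (intro deriv_cong_ev) (auto elim: eventually_mono simp: hom)
  ultimately show "derivation B (seq_scale c x) j = seq_scale c (derivation B x) j"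
    by (simp add: derivation_def)
qed

text \<open>Differentiating |v|^(1/2 - z) |w|^(z - 1/2) at 1/2, where both powers equal 1, leaves ln
  |w| - ln |v|. Off the support of \<open>u\<close> the selected function is identically 0.\<close>

lemma derivation_factorization:
  assumes "selection V0 N0 V1 N1 B" "u \<in> c00" "l2_norm u = 1"
  shows "\<exists>v w. lozanovskii_factorization V0 N0 V1 N1 u v w \<and>
    derivation B u = (\<lambda>j. u j * complex_of_real (ln (cmod (w j)) - ln (cmod (v j))))"
proof -
  from assms obtain v w where vw: "lozanovskii_factorization V0 N0 V1 N1 u v w"
    and B: "\<And>z j. z \<in> strip \<Longrightarrow> B u z j = u j * complex_of_real (cmod (v j)) powr (1 / 2 - z)
                  * complex_of_real (cmod (w j)) powr (z - 1 / 2)"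
    unfolding selection_def by metis
  have "derivation B u j = u j * complex_of_real (ln (cmod (w j)) - ln (cmod (v j)))" for j
  proof (cases "u j = 0")
    case True
    have "deriv (\<lambda>z. B u z j) (1 / 2) = deriv (\<lambda>z. 0) (1 / 2)"
      using eventually_strip by (intro deriv_cong_ev) (auto elim: eventually_mono simp: B True)
    then show ?thesis using True by (simp add: derivation_def)
  next
    case False
    then have nz: "v j \<noteq> 0" "w j \<noteq> 0" using vw by (auto simp: lozanovskii_factorization_def supp_def)
    define s t where "s = complex_of_real (ln (cmod (v j)))" and "t = complex_of_real (ln (cmod (w j)))"
    have "deriv (\<lambda>z. B u z j) (1 / 2) = deriv (\<lambda>z. u j * exp ((1 / 2 - z) * s) * exp ((z - 1 / 2) * t)) (1 / 2)"
      using eventually_strip nz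
      by (intro deriv_cong_ev) (auto elim!: eventually_mono simp: B powr_def Ln_of_real s_def t_def)
    also have "((\<lambda>z. u j * exp ((1 / 2 - z) * s) * exp ((z - 1 / 2) * t)) has_field_derivative u j * (t - s)) (at (1 / 2))"
      by (auto intro!: derivative_eq_intros simp: algebra_simps)
    then have "deriv (\<lambda>z. u j * exp ((1 / 2 - z) * s) * exp ((z - 1 / 2) * t)) (1 / 2) = u j * (t - s)"
      by (rule DERIV_imp_deriv)
    finally show ?thesis by (simp add: derivation_def s_def t_def)
  qed
  with vw show ?thesis by blast
qed

text \<open>To be read with f and g as the norms of two vectors that differ by at most D r, r as the
  norm of the second coordinate, and c = |2 - 4/p|.\<close>

lemma perturbed_norm_equivalence:
  fixes f g r c D :: real
  assumes "0 \<le> f" "0 \<le> g" "0 \<le> r" "0 \<le> D" "0 < c" "f \<le> g + D * r" "g \<le> f + D * r"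
  shows "f + r \<le> (c + D + 1) * (g / c + r) \<and> g / c + r \<le> ((1 + D) / c + 1) * (f + r)"
proof
  have "(c + D + 1) * (g / c + r) = g + (D + 1) * (g / c) + c * r + (D + 1) * r"
    using assms(5) by (simp add: field_simps)
  moreover have "0 \<le> (D + 1) * (g / c)" "0 \<le> c * r" using assms by auto
  moreover have "(D + 1) * r = D * r + r" by (simp add: algebra_simps)
  ultimately show "f + r \<le> (c + D + 1) * (g / c + r)" using assms(6) by linarith
  have "(1 + D) * (f + r) = f + r + D * f + D * r" by (simp add: algebra_simps)
  moreover have "0 \<le> D * f" using assms by simp
  ultimately have "g \<le> (1 + D) * (f + r)" using assms(3,7) by linarith
  then have "g / c \<le> (1 + D) * (f + r) / c" using assms(5) by (intro divide_right_mono) auto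
  moreover have "((1 + D) / c + 1) * (f + r) = (1 + D) * (f + r) / c + (f + r)"
    by (simp add: distrib_right)
  ultimately show "g / c + r \<le> ((1 + D) / c + 1) * (f + r)" using assms(1) by linarith
qed

context one_unconditional_space
begin

abbreviation "selected B \<equiv> selection (seq_space sc e) (seq_norm sc e N)
   (dual_seq_space sc e) (dual_seq_norm sc e N) B"

text \<open>Keeps all vectors of the later triangle inequalities inside \<open>l2\<close>.\<close>

lemma derivation_c00:
  assumes "selected B" "x \<in> c00"
  shows "derivation B x \<in> c00"
proof (cases "x = 0")
  case True
  have "seq_scale 0 z = 0" for z by (simp add: fun_eq_iff)
  then show ?thesis using derivation_scale[OF assms(1) zero_l2, of 0] True by (simp add: c00_zero)
next
  case False
  then have r: "0 < l2_norm x" using l2_norm_eq_0 l2_norm_nonneg c00_l2 assms(2) by (metis order_le_less)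
  define u where "u = seq_scale (complex_of_real (1 / l2_norm x)) x"
  have u: "u \<in> c00" "l2_norm u = 1" "x = seq_scale (complex_of_real (l2_norm x)) u"
    using assms(2) r by (auto simp: u_def c00_scale l2_norm_scale c00_l2 norm_divide fun_eq_iff)
  obtain v w where "derivation B u = (\<lambda>j. u j * complex_of_real (ln (cmod (w j)) - ln (cmod (v j))))"
    using derivation_factorization[OF assms(1) u(1,2)] by blast
  then have "derivation B u \<in> c00" using u(1) unfolding in_c00_iff by auto
  then show ?thesis
    using derivation_scale[OF assms(1) c00_l2[OF u(1)], of "complex_of_real (l2_norm x)"] u(3) c00_scale by metis
qed

text \<open>Homogeneous form of the stability estimate. Dividing \<open>b\<close> by its norm r
  turns ln |b j| into ln (|b j| / r), the shape found in the Kalton-Peck map.\<close>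

lemma derivation_block_sum:
  assumes "1 \<le> p" "asymptotic_lp sc e p" "selected B"
  obtains D where "0 \<le> D" "\<And>n U b. far_blocks n U \<Longrightarrow> (\<And>j. j < n \<Longrightarrow> l2_norm (U j) = 1) \<Longrightarrow>
     l2_norm ((\<Sum>j<n. seq_scale (b j) (derivation B (U j))) - derivation B (\<Sum>j<n. seq_scale (b j) (U j))
        + (\<Sum>j<n. seq_scale (b j * complex_of_real ((2 - 4 / p) * ln (cmod (b j) / L2_set (\<lambda>j. cmod (b j)) {..<n}))) (U j)))
     \<le> D * L2_set (\<lambda>j. cmod (b j)) {..<n}"
proof -
  obtain D where D: "0 \<le> D" "\<And>n U b V W y v w. far_blocks n U \<Longrightarrow>
     (\<And>j. j < n \<Longrightarrow> factorization (U j) (V j) (W j)) \<Longrightarrow> (\<Sum>j<n. (cmod (b j))\<^sup>2) = 1 \<Longrightarrow>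
     y = (\<Sum>j<n. seq_scale (b j) (U j)) \<Longrightarrow> factorization y v w \<Longrightarrow>
     l2_norm ((\<Sum>j<n. seq_scale (b j) (\<lambda>i. U j i * complex_of_real (ln (cmod (W j i)) - ln (cmod (V j i)))))
        - (\<lambda>i. y i * complex_of_real (ln (cmod (w i)) - ln (cmod (v i))))
        + (\<Sum>j<n. seq_scale (b j * complex_of_real ((2 - 4 / p) * ln (cmod (b j)))) (U j))) \<le> D"
    using block_stability[OF assms(1,2)] by blast
  let ?\<Omega> = "derivation B"
  show thesis
  proof (rule that[OF D(1)])
    fix n U and b :: "nat \<Rightarrow> complex"
    assume U: "far_blocks n U" and U1: "\<And>j. j < n \<Longrightarrow> l2_norm (U j) = 1"
    let ?r = "L2_set (\<lambda>j. cmod (b j)) {..<n}"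
    let ?E = "(\<Sum>j<n. seq_scale (b j) (?\<Omega> (U j))) - ?\<Omega> (\<Sum>j<n. seq_scale (b j) (U j))
        + (\<Sum>j<n. seq_scale (b j * complex_of_real ((2 - 4 / p) * ln (cmod (b j) / ?r))) (U j))"
    have Uc: "U j \<in> c00" if "j < n" for j using U that by (simp add: far_blocks_def)
    note disj = far_blocks_disjoint[OF U]
    show "l2_norm ?E \<le> D * ?r"
    proof (cases "?r = 0")
      case True
      then have b0: "b j = 0" if "j < n" for j using that by (simp add: L2_set_eq_0_iff)
      have z: "seq_scale 0 x = 0" for x by (simp add: fun_eq_iff)
      have "?\<Omega> 0 = 0" using derivation_scale[OF assms(3) zero_l2, of 0] by (simp add: z)
      then have "?E = 0" by (simp add: b0 z)
      then show ?thesis using True by simp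
    next
      case False
      then have r: "0 < ?r" using L2_set_nonneg[of "\<lambda>j. cmod (b j)" "{..<n}"] by linarith
      define b' where "b' j = b j / complex_of_real ?r" for j
      have bb: "b j = complex_of_real ?r * b' j" for j using r by (simp add: b'_def)
      have nb: "cmod (b' j) = cmod (b j) / ?r" for j using r by (simp add: b'_def norm_divide)
      have sq: "(\<Sum>j<n. (cmod (b' j))\<^sup>2) = 1"
      proof -
        have "(\<Sum>j<n. (cmod (b' j))\<^sup>2) = (\<Sum>j<n. (cmod (b j))\<^sup>2) / ?r\<^sup>2"
          by (simp add: nb power_divide sum_divide_distrib)
        also have "(\<Sum>j<n. (cmod (b j))\<^sup>2) = ?r\<^sup>2" by (simp add: L2_set_def sum_nonneg)
        finally show ?thesis using r by simp
      qed
      define y where "y = (\<Sum>j<n. seq_scale (b' j) (U j))"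
      have yc: "y \<in> c00" unfolding y_def using Uc by (intro c00_sum c00_scale) auto
      have "l2_norm y = L2_set (\<lambda>j. cmod (b' j)) {..<n}"
        unfolding y_def using Uc U1 disj by (intro l2_norm_block_sum) auto
      then have y1: "l2_norm y = 1" using sq by (simp add: L2_set_def)
      have "\<forall>j. \<exists>V. \<exists>W. j < n \<longrightarrow> factorization (U j) V W \<and>
          ?\<Omega> (U j) = (\<lambda>i. U j i * complex_of_real (ln (cmod (W i)) - ln (cmod (V i))))"
        using derivation_factorization[OF assms(3) Uc U1] by blast
      from choice[OF this] obtain V where "\<forall>j. \<exists>W. j < n \<longrightarrow> factorization (U j) (V j) W \<and>
          ?\<Omega> (U j) = (\<lambda>i. U j i * complex_of_real (ln (cmod (W i)) - ln (cmod (V j i))))" ..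
      from choice[OF this] obtain W where "\<forall>j. j < n \<longrightarrow> factorization (U j) (V j) (W j) \<and>
          ?\<Omega> (U j) = (\<lambda>i. U j i * complex_of_real (ln (cmod (W j i)) - ln (cmod (V j i))))" ..
      then have VW: "\<And>j. j < n \<Longrightarrow> factorization (U j) (V j) (W j)"
        "\<And>j. j < n \<Longrightarrow> ?\<Omega> (U j) = (\<lambda>i. U j i * complex_of_real (ln (cmod (W j i)) - ln (cmod (V j i))))"
        by simp_all
      obtain v w where vw: "factorization y v w"
        "?\<Omega> y = (\<lambda>i. y i * complex_of_real (ln (cmod (w i)) - ln (cmod (v i))))"
        using derivation_factorization[OF assms(3) yc y1] by blast
      let ?E' = "(\<Sum>j<n. seq_scale (b' j) (?\<Omega> (U j))) - ?\<Omega> y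
        + (\<Sum>j<n. seq_scale (b' j * complex_of_real ((2 - 4 / p) * ln (cmod (b' j)))) (U j))"
      have "(\<Sum>j<n. seq_scale (b' j) (?\<Omega> (U j)))
          = (\<Sum>j<n. seq_scale (b' j) (\<lambda>i. U j i * complex_of_real (ln (cmod (W j i)) - ln (cmod (V j i)))))"
        using VW(2) by (intro sum.cong refl) auto
      then have E'D: "l2_norm ?E' \<le> D"
        using D(2)[OF U VW(1) sq y_def vw(1)] unfolding vw(2) by simp
      have sums: "(\<Sum>j<n. seq_scale (complex_of_real ?r * c j) (G j)) = seq_scale (complex_of_real ?r) (\<Sum>j<n. seq_scale (c j) (G j))" for c G
        by (simp add: fun_eq_iff sum_fun_apply sum_distrib_left mult.assoc)
      have ysc: "(\<Sum>j<n. seq_scale (b j) (U j)) = seq_scale (complex_of_real ?r) y"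
        unfolding y_def sums[symmetric] by (simp add: bb[symmetric])
      have "?\<Omega> (\<Sum>j<n. seq_scale (b j) (U j)) = seq_scale (complex_of_real ?r) (?\<Omega> y)"
        unfolding ysc by (rule derivation_scale[OF assms(3) c00_l2[OF yc]])
      moreover have "(\<Sum>j<n. seq_scale (b j) (?\<Omega> (U j))) = seq_scale (complex_of_real ?r) (\<Sum>j<n. seq_scale (b' j) (?\<Omega> (U j)))"
        unfolding sums[symmetric] by (simp add: bb[symmetric])
      moreover have "(\<Sum>j<n. seq_scale (b j * complex_of_real ((2 - 4 / p) * ln (cmod (b j) / ?r))) (U j))
         = seq_scale (complex_of_real ?r) (\<Sum>j<n. seq_scale (b' j * complex_of_real ((2 - 4 / p) * ln (cmod (b' j)))) (U j))"
        unfolding sums[symmetric] nb mult.assoc[symmetric] bb[symmetric] ..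
      ultimately have EE: "?E = seq_scale (complex_of_real ?r) ?E'"
        by (simp only: fun_eq_iff seq_scale_apply plus_fun_apply minus_apply algebra_simps) simp
      have "?E' \<in> l2"
      proof -
        have "(\<Sum>j<n. seq_scale (b' j) (?\<Omega> (U j))) \<in> l2"
          using derivation_c00[OF assms(3)] Uc by (intro c00_l2 c00_sum c00_scale) auto
        moreover have "(\<Sum>j<n. seq_scale (b' j * complex_of_real ((2 - 4 / p) * ln (cmod (b' j)))) (U j)) \<in> l2"
          using Uc by (intro c00_l2 c00_sum c00_scale) auto
        ultimately show ?thesis using c00_l2[OF derivation_c00[OF assms(3) yc]] by (intro l2_add(1) l2_diff(1))
      qed
      then have "l2_norm ?E = ?r * l2_norm ?E'" unfolding EE using r by (simp add: l2_norm_scale)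
      also have "\<dots> \<le> ?r * D" using E'D r by (intro mult_left_mono) auto
      finally show ?thesis by (simp add: mult.commute)
    qed
  qed
qed

text \<open>With c = 2 - 4/p, the first part F of the twisted norm splits as G + H. H obeys the
  block sum estimate, and G has coefficients a j - c b j ln (|b j| / r). As the blocks are
  orthonormal, its norm is exactly |c| times that of a / c minus the Kalton-Peck map of b.\<close>

lemma twisted_norm_block_sum:
  assumes p: "1 \<le> p" "p \<noteq> 2" and "asymptotic_lp sc e p" and sel: "selected B"
  obtains A A' where "0 < A" "0 < A'" "\<And>n U a b. far_blocks n U \<Longrightarrow> (\<And>j. j < n \<Longrightarrow> l2_norm (U j) = 1) \<Longrightarrow>
     twisted_norm (derivation B) ((\<Sum>j<n. seq_scale (a j) (U j)) + (\<Sum>j<n. seq_scale (b j) (derivation B (U j))),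
            \<Sum>j<n. seq_scale (b j) (U j))
       \<le> A * Z2_norm (seq_scale (complex_of_real (1 / (2 - 4 / p))) (truncate n a), truncate n b) \<and>
     Z2_norm (seq_scale (complex_of_real (1 / (2 - 4 / p))) (truncate n a), truncate n b)
       \<le> A' * twisted_norm (derivation B) ((\<Sum>j<n. seq_scale (a j) (U j)) + (\<Sum>j<n. seq_scale (b j) (derivation B (U j))),
            \<Sum>j<n. seq_scale (b j) (U j))"
proof -
  let ?\<Omega> = "derivation B"
  define c where "c = 2 - 4 / p"
  have c: "c \<noteq> 0" using p by (auto simp: c_def field_simps)
  obtain D where D: "0 \<le> D" "\<And>n U b. far_blocks n U \<Longrightarrow> (\<And>j. j < n \<Longrightarrow> l2_norm (U j) = 1) \<Longrightarrow>
     l2_norm ((\<Sum>j<n. seq_scale (b j) (?\<Omega> (U j))) - ?\<Omega> (\<Sum>j<n. seq_scale (b j) (U j))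
        + (\<Sum>j<n. seq_scale (b j * complex_of_real (c * ln (cmod (b j) / L2_set (\<lambda>j. cmod (b j)) {..<n}))) (U j)))
     \<le> D * L2_set (\<lambda>j. cmod (b j)) {..<n}"
    using derivation_block_sum[OF p(1) assms(3) sel] unfolding c_def by blast
  show thesis
  proof (rule that[of "\<bar>c\<bar> + D + 1" "(1 + D) / \<bar>c\<bar> + 1"])
    fix n U and a b :: "nat \<Rightarrow> complex"
    assume U: "far_blocks n U" and U1: "\<And>j. j < n \<Longrightarrow> l2_norm (U j) = 1"
    let ?r = "L2_set (\<lambda>j. cmod (b j)) {..<n}"
    have Uc: "U j \<in> c00" if "j < n" for j using U that by (simp add: far_blocks_def)
    have ortho: "l2_norm (\<Sum>j<n. seq_scale (d j) (U j)) = L2_set (\<lambda>j. cmod (d j)) {..<n}" for d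
      using Uc U1 far_blocks_disjoint[OF U] by (intro l2_norm_block_sum) auto
    have trunc: "l2_norm (truncate n d) = L2_set (\<lambda>j. cmod (d j)) {..<n}" for d
    proof -
      have "l2_norm (truncate n d) = L2_set (\<lambda>j. cmod (truncate n d j)) {..<n}"
        by (intro l2_norm_finite) (auto simp: truncate_def)
      also have "\<dots> = L2_set (\<lambda>j. cmod (d j)) {..<n}" by (intro L2_set_cong) (auto simp: truncate_def)
      finally show ?thesis .
    qed
    define y where "y = (\<Sum>j<n. seq_scale (b j) (U j))"
    define H where "H = (\<Sum>j<n. seq_scale (b j) (?\<Omega> (U j))) - ?\<Omega> y
        + (\<Sum>j<n. seq_scale (b j * complex_of_real (c * ln (cmod (b j) / ?r))) (U j))"
    define d where "d j = a j - b j * complex_of_real (c * ln (cmod (b j) / ?r))" for j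
    define G where "G = (\<Sum>j<n. seq_scale (d j) (U j))"
    define F where "F = (\<Sum>j<n. seq_scale (a j) (U j)) + (\<Sum>j<n. seq_scale (b j) (?\<Omega> (U j))) - ?\<Omega> y"
    have yc: "y \<in> c00" unfolding y_def using Uc by (intro c00_sum c00_scale) auto
    have Hl: "H \<in> l2" unfolding H_def using Uc derivation_c00[OF sel] yc
      by (intro l2_add(1) l2_diff(1) c00_l2 c00_sum c00_scale) auto
    have Gl: "G \<in> l2" unfolding G_def using Uc by (intro c00_l2 c00_sum c00_scale) auto
    have HD: "l2_norm H \<le> D * ?r" unfolding H_def y_def using D(2)[OF U U1] .
    have FGH: "F = G + H"
      by (simp add: fun_eq_iff F_def G_def H_def d_def sum_fun_apply algebra_simps sum_subtractf)
    have HFG: "G = F - H" by (simp add: FGH)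
    have Fl: "F \<in> l2" unfolding FGH using Gl Hl by (rule l2_add(1))
    have FG: "l2_norm F \<le> l2_norm G + D * ?r" using l2_add(2)[OF Gl Hl] HD by (simp add: FGH)
    have GF: "l2_norm G \<le> l2_norm F + D * ?r" using l2_diff(2)[OF Fl Hl] HD by (simp add: HFG)
    have f: "twisted_norm ?\<Omega> ((\<Sum>j<n. seq_scale (a j) (U j)) + (\<Sum>j<n. seq_scale (b j) (?\<Omega> (U j))),
            \<Sum>j<n. seq_scale (b j) (U j)) = l2_norm F + ?r"
      by (simp add: twisted_norm_def F_def y_def ortho)
    have "kalton_peck_map (truncate n b) = (\<lambda>j. if j < n then b j * complex_of_real (ln (cmod (b j) / ?r)) else 0)"
      unfolding kalton_peck_map_def trunc by (auto simp: truncate_def)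
    then have "seq_scale (complex_of_real (1 / c)) (truncate n a) - kalton_peck_map (truncate n b)
        = seq_scale (complex_of_real (1 / c)) (truncate n d)"
      using c by (simp add: fun_eq_iff truncate_def d_def diff_divide_distrib)
    then have g: "Z2_norm (seq_scale (complex_of_real (1 / c)) (truncate n a), truncate n b)
        = l2_norm G / \<bar>c\<bar> + ?r"
      by (simp add: Z2_norm_eq trunc G_def ortho l2_norm_scale c00_l2 truncate_c00 norm_divide)
    have r: "0 \<le> ?r" and Gn: "0 \<le> l2_norm G" and Fn: "0 \<le> l2_norm F" using Gl Fl by auto
    note cmp = perturbed_norm_equivalence[OF Fn Gn r D(1) _ FG GF, of "\<bar>c\<bar>"]
    show "twisted_norm (derivation B) ((\<Sum>j<n. seq_scale (a j) (U j)) + (\<Sum>j<n. seq_scale (b j) (derivation B (U j))),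
            \<Sum>j<n. seq_scale (b j) (U j))
       \<le> (\<bar>c\<bar> + D + 1) * Z2_norm (seq_scale (complex_of_real (1 / (2 - 4 / p))) (truncate n a), truncate n b) \<and>
     Z2_norm (seq_scale (complex_of_real (1 / (2 - 4 / p))) (truncate n a), truncate n b)
       \<le> ((1 + D) / \<bar>c\<bar> + 1) * twisted_norm (derivation B) ((\<Sum>j<n. seq_scale (a j) (U j)) + (\<Sum>j<n. seq_scale (b j) (derivation B (U j))),
            \<Sum>j<n. seq_scale (b j) (U j))"
      unfolding f c_def[symmetric] g using cmp c by simp
  qed (use D(1) in \<open>auto intro: add_nonneg_pos\<close>)
qed

end

section \<open>Passage to spreading limits and to the completions\<close>

lemma normalized_blocks_far:
  assumes u: "normalized_consecutive_blocks u" and k: "strict_mono_on {..<n} k" "\<And>j. j < n \<Longrightarrow> n < k j"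
  shows "far_blocks n (\<lambda>j. u (k j))"
proof -
  have u': "u j \<in> c00" "l2_norm (u j) = 1" "block_less (u j) (u (Suc j))" for j
    using u by (auto simp: normalized_consecutive_blocks_def)
  have nz: "u j \<noteq> 0" for j using u'(2)[of j] by auto
  have less: "block_less (u i) (u j)" if "i < j" for i j
    by (rule block_less_chain[of "Suc j" u]) (use nz u' that in auto)
  \<comment> \<open>Each earlier block is nonzero and occupies a coordinate of its own, so indices
    beyond n give blocks supported beyond n.\<close>
  have far: "\<forall>i\<in>supp (u j). j \<le> i" for j
  proof (induction j)
    case (Suc j)
    obtain l where "l \<in> supp (u j)" using nz[of j] supp_eq_empty[of "u j"] by auto
    then show ?case using Suc u'(3)[of j] unfolding block_less_def by (metis Suc_leI le_less_trans)
  qed simp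
  show ?thesis unfolding far_blocks_def
  proof (intro conjI allI impI ballI)
    fix j i assume "j < n" "i \<in> supp (u (k j))"
    then show "n \<le> i" using far[of "k j"] k(2)[of j] by auto
  next
    fix j assume "Suc j < n"
    then show "block_less (u (k j)) (u (k (Suc j)))"
      using k(1) by (intro less) (auto simp: strict_mono_on_def)
  qed (use u' nz in auto)
qed

lemma spreading_limit_le:
  assumes "spreading_limit n f L" "spreading_limit n g M" "0 \<le> A"
    and "\<And>k. strict_mono_on {..<n} k \<Longrightarrow> (\<And>j. j < n \<Longrightarrow> n < k j) \<Longrightarrow> f k \<le> A * g k"
  shows "L \<le> A * M"
proof (rule field_le_epsilon)
  fix \<epsilon> :: real assume e: "0 < \<epsilon>"
  define d where "d = \<epsilon> / (1 + A)"
  have d: "0 < d" using e assms(3) by (simp add: d_def)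
  obtain \<nu> \<nu>' where nu: "\<forall>k. strict_mono_on {..<n} k \<and> (\<forall>j<n. \<nu> < k j) \<longrightarrow> \<bar>f k - L\<bar> < d"
    "\<forall>k. strict_mono_on {..<n} k \<and> (\<forall>j<n. \<nu>' < k j) \<longrightarrow> \<bar>g k - M\<bar> < d"
    using assms(1,2) d unfolding spreading_limit_def by metis
  \<comment> \<open>One index choice past both thresholds and past n suffices to compare the two
    limits.\<close>
  define k where "k j = \<nu> + \<nu>' + n + 1 + j" for j :: nat
  have k: "strict_mono_on {..<n} k" by (auto simp: strict_mono_on_def k_def)
  have "\<bar>f k - L\<bar> < d" "\<bar>g k - M\<bar> < d" using nu k by (auto simp: k_def)
  moreover have "f k \<le> A * g k" using assms(4)[OF k] by (auto simp: k_def)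
  moreover have "A * g k \<le> A * (M + d)" using \<open>\<bar>g k - M\<bar> < d\<close> assms(3) by (intro mult_left_mono) auto
  moreover have "A * (M + d) + d = A * M + (1 + A) * d" by (simp add: algebra_simps)
  moreover have "(1 + A) * d = \<epsilon>" using assms(3) by (simp add: d_def)
  ultimately show "L \<le> A * M + \<epsilon>" by linarith
qed

text \<open>Lets the Kalton-Peck quasi-norm, which does not depend on the chosen indices, enter the
  comparison of spreading limits.\<close>

lemma spreading_limit_const: "spreading_limit n (\<lambda>_. L) L"
  by (simp add: spreading_limit_def)

lemma subspace_c00: "module.subspace seq2_scale (c00 \<times> c00)"
proof -
  interpret vector_space seq2_scale by (rule vector_space_seq2)
  show ?thesis
    by (rule subspaceI) (auto simp: zero_prod_def c00_zero c00_add c00_scale seq2_scale_def)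
qed

text \<open>The rescaling sits in the embedding, so that \<open>Z2\<close> becomes a completion of
  the same vector space \<open>c00 \<times> c00\<close> that the spreading model completes.\<close>

lemma Z2_completion:
  assumes "c \<noteq> 0"
  shows "is_completion seq2_scale (c00 \<times> c00) (\<lambda>p. Z2_norm (seq_scale (1 / c) (fst p), snd p))
    seq2_scale Z2 Z2_norm (\<lambda>p. (seq_scale (1 / c) (fst p), snd p))"
  unfolding is_completion_def
proof (intro conjI ballI allI impI)
  show "linear_between seq2_scale (c00 \<times> c00) seq2_scale Z2 (\<lambda>p. (seq_scale (1 / c) (fst p), snd p))"
    unfolding linear_between_def
  proof (intro conjI ballI allI)
    show "(\<lambda>p. (seq_scale (1 / c) (fst p), snd p)) ` (c00 \<times> c00) \<subseteq> Z2"
    proof (rule image_subsetI)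
      fix p :: "cseq \<times> cseq" assume "p \<in> c00 \<times> c00"
      then show "(seq_scale (1 / c) (fst p), snd p) \<in> Z2"
        by (intro c00_Z2 c00_scale) (auto simp: mem_Times_iff)
    qed
  qed (auto simp: seq2_scale_def fun_eq_iff algebra_simps)
  fix z and \<epsilon> :: real assume "z \<in> Z2" "0 < \<epsilon>"
  then obtain a b where ab: "a \<in> c00" "b \<in> c00" "Z2_norm (z - (a, b)) < \<epsilon>" using Z2_c00_dense by blast
  have "seq_scale (1 / c) (seq_scale c a) = a" using assms by (simp add: fun_eq_iff)
  then show "\<exists>x\<in>c00 \<times> c00. Z2_norm (z - (seq_scale (1 / c) (fst x), snd x)) < \<epsilon>"
    using ab by (intro bexI[of _ "(seq_scale c a, b)"]) (auto intro: c00_scale)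
qed (auto simp: quasi_normed_space_Z2 Z2_complete)

lemma c00_truncate:
  assumes "a \<in> c00" "b \<in> c00"
  obtains n where "truncate n a = a" "truncate n b = b"
proof -
  obtain n m where "\<forall>j\<ge>n. a j = 0" "\<forall>j\<ge>m. b j = 0" using assms unfolding in_c00_iff by blast
  then show thesis by (intro that[of "max n m"]) (auto simp: truncate_def fun_eq_iff)
qed

theorem theorem4:
  fixes sc :: "complex \<Rightarrow> 'a::banach \<Rightarrow> 'a" and e :: "nat \<Rightarrow> 'a"
    and N :: "'a \<Rightarrow> real" and p :: real
    and B :: "cseq \<Rightarrow> complex \<Rightarrow> cseq"
    and s :: "complex \<Rightarrow> 'b::ab_group_add \<Rightarrow> 'b" and V :: "'b set" and Q :: "'b \<Rightarrow> real"
  assumes "complex_banach sc"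
    and "unconditional_basis sc e" and "shrinking_basis sc e"
    and "1 \<le> p" and "p \<noteq> 2"
    and "asymptotic_lp sc e p"
    and "equivalent_norm sc N" and "one_unconditional sc e N"
    and "selection (seq_space sc e) (seq_norm sc e N)
           (dual_seq_space sc e) (dual_seq_norm sc e N) B"
    and "twisted_spreading_model (derivation B) s V Q"
  shows "isomorphic_spaces s V Q seq2_scale
           (twisted_space kalton_peck_map) (twisted_norm kalton_peck_map)"
proof -
  interpret complex_banach sc by fact
  interpret one_unconditional_space sc e N
    using assms(2,7,8) by unfold_locales (auto simp: unconditional_basis_def)
  define c where "c = complex_of_real (2 - 4 / p)"
  \<comment> \<open>Here p \<noteq> 2 enters: for p = 2 the logarithmic term would vanish and the
    rescaling by 1 / c would make no sense.\<close>
  have c: "c \<noteq> 0" using assms(4,5) by (auto simp: c_def field_simps simp del: of_real_diff)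
  have c': "1 / c = complex_of_real (1 / (2 - 4 / p))" by (simp add: c_def)
  let ?r = "\<lambda>x. Z2_norm (seq_scale (1 / c) (fst x), snd x)"
  obtain u q \<iota> where u: "normalized_consecutive_blocks u" and q: "spreading_quasi_norm (derivation B) u q"
    and compl: "is_completion seq2_scale (c00 \<times> c00) q s V Q \<iota>"
    using assms(10) unfolding twisted_spreading_model_def by blast
  have u1: "l2_norm (u j) = 1" for j using u by (simp add: normalized_consecutive_blocks_def)
  obtain A A' where A: "0 < A" "0 < A'" and bounds: "\<And>n U a b. far_blocks n U \<Longrightarrow> (\<And>j. j < n \<Longrightarrow> l2_norm (U j) = 1) \<Longrightarrow>
     twisted_norm (derivation B) ((\<Sum>j<n. seq_scale (a j) (U j)) + (\<Sum>j<n. seq_scale (b j) (derivation B (U j))),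
            \<Sum>j<n. seq_scale (b j) (U j)) \<le> A * ?r (truncate n a, truncate n b) \<and>
     ?r (truncate n a, truncate n b)
       \<le> A' * twisted_norm (derivation B) ((\<Sum>j<n. seq_scale (a j) (U j)) + (\<Sum>j<n. seq_scale (b j) (derivation B (U j))),
            \<Sum>j<n. seq_scale (b j) (U j))"
    using twisted_norm_block_sum[OF assms(4,5,6,9)] unfolding c' fst_conv snd_conv by blast
  have "q x \<le> A * ?r x \<and> ?r x \<le> A' * q x" if "x \<in> c00 \<times> c00" for x
  proof -
    obtain a b where x: "x = (a, b)" by (cases x)
    then have "a \<in> c00" "b \<in> c00" using that by auto
    \<comment> \<open>A common length for both sequences makes the spreading limit equal to q x; A
      and A' were fixed before n.\<close>
    then obtain n where n: "truncate n a = a" "truncate n b = b" by (rule c00_truncate)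
    have lim: "spreading_limit n (\<lambda>k. twisted_norm (derivation B)
           ((\<Sum>j<n. seq_scale (a j) (u (k j))) + (\<Sum>j<n. seq_scale (b j) (derivation B (u (k j)))),
            \<Sum>j<n. seq_scale (b j) (u (k j)))) (q x)"
      using q[unfolded spreading_quasi_norm_def, rule_format, of n a b] by (simp only: n x)
    have "far_blocks n (\<lambda>j. u (k j))" if "strict_mono_on {..<n} k" "\<And>j. j < n \<Longrightarrow> n < k j" for k
      using normalized_blocks_far[OF u that] .
    note b = bounds[OF this u1, of _ a b, unfolded n, folded x]
    show ?thesis
      using spreading_limit_le[OF lim spreading_limit_const[of n "?r x"]]
        spreading_limit_le[OF spreading_limit_const[of n "?r x"] lim] A b by (meson less_imp_le)
  qed
  then show ?thesis
    using isomorphic_completions[OF compl Z2_completion[OF c] vector_space_seq2 subspace_c00 A(2) _ A(1)] by blast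
qed

end
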